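(* Let $M$ be a simply connected, compact, oriented smooth manifold of dimension $m$, let $N$ be a simply connected, compact, oriented smooth manifold of dimension $n$, and let $e: N \hookrightarrow M$ be an embedding. Let $f: (A,d) \rightarrow (B,d)$ be a cdga model of $e$, where $(A,d)$ and $(B,d)$ are Poincaré duality algebras of formal dimensions $m$ and $n$ respectively, and assume that $f$ is surjective. Let $[y]\in H^n(B)$ be the fundamental class of $(B,d)$, let $x\in A^n$ be such that $f(x)=y$, and assume that $x$ is a cocycle. Let $f_!: B\rightarrow A$ be the shriek map of $f$, and let $[x^*]\in H^{m-n}(A,d)$ be the Poincaré dual of $[x]$, i.e. the Poincaré dual of the fundamental class of $N$ in $M$. Then the composition $$ HH^*(A;A) \xrightarrow{\;HH^*(f)\;} HH^*(A;B) \xrightarrow{\;HH^*(f_!)\;} HH^*(A;A)$$ is the multiplication by $[x^*]$.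
   Context: All vector spaces are over $\mathbb{Q}$. A cdga is a commutative differential graded algebra $A=\oplus_{p\ge 0}A^p$ with differential of degree $+1$. A cdga model of a map $e:N\to M$ is a morphism of cdga's $f:(A,d)\to(B,d)$ connected by quasi-isomorphisms to $A_{PL}(e):A_{PL}(M)\to A_{PL}(N)$, where $A_{PL}$ is Sullivan's functor of piecewise linear forms. A cdga $(A,d)$ is a Poincaré duality algebra of formal dimension $n$ if $A$ is connected and there is a linear map $\epsilon_A: A^n\to\mathbb{Q}$ with $\epsilon_A(dA^{n-1})=0$ such that the bilinear forms $A^k\otimes A^{n-k}\to\mathbb{Q}$, $x\otimes y\mapsto \epsilon_A(xy)$, are non-degenerate. Here $A$ is of finite type (hence finite dimensional, with $A^i=0$ for $i>n$). Write $A^{\#}=\mathrm{Hom}(A,\mathbb{Q})$; then there is an isomorphism of $A$-modules $\pi_A: A\to A^{\#}$, $\pi_A(a)(z)=\epsilon_A(az)$ (with $\epsilon_A$ extended by $0$ to the other degrees). The fundamental class of $(B,d)$ is the class $[\omega_B]\in H^n(B)$ with $\epsilon_B(\omega_B)=1$, and $\omega_B^{\#}=\pi_B(1)=\epsilon_B\in B^{\#}$. $B$ is an $A$-module via $a*b=f(a)b$. Let $f^{\#}:B^{\#}\to A^{\#}$, $f^{\#}(\varphi)=\varphi\circ f$. Let $\alpha\in A^{m-n}$ be the element determined by $\pi_A(\alpha)=f^{\#}(\omega_B^{\#})$, that is, $\epsilon_A(\alpha a)=\epsilon_B(f(a))$ for all $a\in A$. The shriek map $f_!: B\to A$ is the morphism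 of $A$-modules, of degree $m-n$, with $\pi_A\circ f_!=f^{\#}\circ\pi_B$; it satisfies $f_!(1)=\alpha$ and is given by $f_!(f(a))=a\alpha$ (up to Koszul signs). The element $x^*$ is the dual of $x$ with respect to a suitable homogeneous basis of $A$ and its $\epsilon_A$-dual basis, chosen so that $\pi_A(x^* )=x^{\#}=f^{\#}(\omega_B^{\#})$; thus $x^*=\alpha$. Hochschild cohomology of $A$ with coefficients in a differential graded $A$-bimodule $Q$ is $HH^*(A;Q)=\mathrm{Ext}_{A^e}(A,Q)$, $A^e=A\otimes A^{opp}$. If $(\land V,d)\to(A,d)$ is a minimal Sullivan model and $Q$ is a differential graded $A$-module (regarded as a symmetric bimodule), then it is the cohomology of $\mathrm{Hom}_{\land V}(\land V\otimes\land\bar V,Q)$, where $\bar V=sV$ (so $\bar V^{k}=V^{k+1}$), $\land V\otimes\land \bar V$ has differential $Dv=dv$, $D\bar v=-S(dv)$, and $S$ is the derivation with $Sv=\bar v$, $S\bar v=0$. $HH^*(f)$ and $HH^*(f_!)$ are the maps induced by composing cochains with the $A$-linear maps $f:A\to B$ and $f_!:B\to A$. Multiplication by a class of $H^*(A)$ on $HH^*(A;A)$ is the $H^*(A)$-module structure induced by the $A$-module structure on coefficients. *)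

theory Defs
  imports
    "HOL-Analysis.Analysis"
    "HOL-Homology.Homology"
    "HOL-Library.Function_Algebras"
    "HOL-Library.Poly_Mapping"
    "HOL-Combinatorics.Permutations"
begin

section \<open>Differential graded linear algebra over the rationals\<close>

text \<open>
  A graded vector space is an internal direct sum of subspaces \<open>gr X p\<close> (\<open>p\<close> an integer) of an
  ambient rational vector space; only the sum \<open>total X\<close> of these subspaces matters, and the
  operations are unconstrained outside of it.
\<close>

record 'a dgspace =
  scl :: "rat \<Rightarrow> 'a \<Rightarrow> 'a"
  gr :: "int \<Rightarrow> 'a set"
  dif :: "'a \<Rightarrow> 'a"

record 'a dgalgebra = "'a dgspace" +
  mul :: "'a \<Rightarrow> 'a \<Rightarrow> 'a"
  uni :: "'a"

record ('a, 'q) dgbimodule = "'q dgspace" +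
  lact :: "'a \<Rightarrow> 'q \<Rightarrow> 'q"
  ract :: "'q \<Rightarrow> 'a \<Rightarrow> 'q"

definition koszul :: "int \<Rightarrow> rat" where
  "koszul p = (if even p then 1 else -1)"

definition qspan :: "('a::ab_group_add, 'z) dgspace_scheme \<Rightarrow> 'a set \<Rightarrow> 'a set" where
  "qspan X S = Modules.module.span (scl X) S"

definition total :: "('a::ab_group_add, 'z) dgspace_scheme \<Rightarrow> 'a set" where
  "total X = qspan X (\<Union>p. gr X p)"

definition linear_on_total ::
  "('a::ab_group_add, 'y) dgspace_scheme \<Rightarrow> ('b::ab_group_add, 'z) dgspace_scheme \<Rightarrow> ('a \<Rightarrow> 'b) \<Rightarrow> bool"
where
  "linear_on_total X Y g \<longleftrightarrow>
     (\<forall>x \<in> total X. g x \<in> total Y) \<and>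
     (\<forall>x \<in> total X. \<forall>y \<in> total X. g (x + y) = g x + g y) \<and>
     (\<forall>c. \<forall>x \<in> total X. g (scl X c x) = scl Y c (g x))"

definition graded_linear ::
  "('a::ab_group_add, 'y) dgspace_scheme \<Rightarrow> ('b::ab_group_add, 'z) dgspace_scheme \<Rightarrow> int \<Rightarrow> ('a \<Rightarrow> 'b) \<Rightarrow> bool"
where
  "graded_linear X Y k g \<longleftrightarrow> linear_on_total X Y g \<and> (\<forall>p. \<forall>x \<in> gr X p. g x \<in> gr Y (p + k))"

definition graded_bilinear ::
  "('a::ab_group_add, 'x) dgspace_scheme \<Rightarrow> ('b::ab_group_add, 'y) dgspace_scheme \<Rightarrow>
   ('c::ab_group_add, 'z) dgspace_scheme \<Rightarrow> ('a \<Rightarrow> 'b \<Rightarrow> 'c) \<Rightarrow> bool"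
where
  "graded_bilinear X Y Z g \<longleftrightarrow>
     (\<forall>x \<in> total X. linear_on_total Y Z (g x)) \<and>
     (\<forall>y \<in> total Y. linear_on_total X Z (\<lambda>x. g x y)) \<and>
     (\<forall>p q. \<forall>x \<in> gr X p. \<forall>y \<in> gr Y q. g x y \<in> gr Z (p + q))"

definition dg_space :: "('a::ab_group_add, 'z) dgspace_scheme \<Rightarrow> bool" where
  "dg_space X \<longleftrightarrow>
     vector_space (scl X) \<and>
     (\<forall>p. Modules.module.subspace (scl X) (gr X p)) \<and>
     (\<forall>S x. finite S \<and> (\<forall>p \<in> S. x p \<in> gr X p) \<and> (\<Sum>p\<in>S. x p) = 0 \<longrightarrow> (\<forall>p \<in> S. x p = 0)) \<and>
     graded_linear X X 1 (dif X) \<and>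
     (\<forall>x \<in> total X. dif X (dif X x) = 0)"

definition homogeneous_basis :: "('a::ab_group_add, 'z) dgspace_scheme \<Rightarrow> 'a set \<Rightarrow> bool" where
  "homogeneous_basis X S \<longleftrightarrow>
     S \<subseteq> (\<Union>p. gr X p) \<and> \<not> Modules.module.dependent (scl X) S \<and> qspan X S = total X"

subsection \<open>Cohomology\<close>

text \<open>
  \<open>Z\<close> are cocycles and \<open>B\<close> coboundaries of some fixed degree; the class of a cocycle is its coset.
\<close>

definition coh_class :: "'a::ab_group_add set \<Rightarrow> 'a set \<Rightarrow> 'a \<Rightarrow> 'a set" where
  "coh_class Z B z = {w \<in> Z. w - z \<in> B}"

definition coh_space :: "'a::ab_group_add set \<Rightarrow> 'a set \<Rightarrow> 'a set set" where
  "coh_space Z B = coh_class Z B ` Z"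

definition cocycles :: "('a::ab_group_add, 'z) dgspace_scheme \<Rightarrow> int \<Rightarrow> 'a set" where
  "cocycles X p = {x \<in> gr X p. dif X x = 0}"

definition coboundaries :: "('a::ab_group_add, 'z) dgspace_scheme \<Rightarrow> int \<Rightarrow> 'a set" where
  "coboundaries X p = dif X ` gr X (p - 1)"

abbreviation cls :: "('a::ab_group_add, 'z) dgspace_scheme \<Rightarrow> int \<Rightarrow> 'a \<Rightarrow> 'a set" where
  "cls X p \<equiv> coh_class (cocycles X p) (coboundaries X p)"

abbreviation cohomology :: "('a::ab_group_add, 'z) dgspace_scheme \<Rightarrow> int \<Rightarrow> 'a set set" where
  "cohomology X p \<equiv> coh_space (cocycles X p) (coboundaries X p)"

text \<open>The map induced on cosets, as in the library's treatment of factor groups.\<close>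

definition iso_on_cohomology ::
  "('a::ab_group_add, 'y) dgspace_scheme \<Rightarrow> ('b::ab_group_add, 'z) dgspace_scheme \<Rightarrow> ('a \<Rightarrow> 'b) \<Rightarrow> bool"
where
  "iso_on_cohomology X Y g \<longleftrightarrow>
     (\<forall>p. bij_betw (\<lambda>c. the_elem ((\<lambda>z. cls Y p (g z)) ` c)) (cohomology X p) (cohomology Y p))"

subsection \<open>Commutative differential graded algebras\<close>

definition cdga :: "'a::ab_group_add dgalgebra \<Rightarrow> bool" where
  "cdga A \<longleftrightarrow>
     dg_space A \<and>
     (\<forall>p < 0. gr A p = {0}) \<and>
     graded_bilinear A A A (mul A) \<and>
     (\<forall>a \<in> total A. \<forall>b \<in> total A. \<forall>c \<in> total A. mul A (mul A a b) c = mul A a (mul A b c)) \<and>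
     uni A \<in> gr A 0 \<and>
     (\<forall>a \<in> total A. mul A (uni A) a = a \<and> mul A a (uni A) = a) \<and>
     (\<forall>p q. \<forall>a \<in> gr A p. \<forall>b \<in> gr A q. mul A a b = scl A (koszul (p * q)) (mul A b a)) \<and>
     (\<forall>p. \<forall>a \<in> gr A p. \<forall>b \<in> total A.
        dif A (mul A a b) = mul A (dif A a) b + scl A (koszul p) (mul A a (dif A b)))"

definition cdga_morphism ::
  "'a::ab_group_add dgalgebra \<Rightarrow> 'b::ab_group_add dgalgebra \<Rightarrow> ('a \<Rightarrow> 'b) \<Rightarrow> bool"
where
  "cdga_morphism A B f \<longleftrightarrow>
     cdga A \<and> cdga B \<and> graded_linear A B 0 f \<and>
     (\<forall>a \<in> total A. \<forall>b \<in> total A. f (mul A a b) = mul B (f a) (f b)) \<and>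
     f (uni A) = uni B \<and>
     (\<forall>a \<in> total A. f (dif A a) = dif B (f a))"

definition cdga_quasi_iso ::
  "'a::ab_group_add dgalgebra \<Rightarrow> 'b::ab_group_add dgalgebra \<Rightarrow> ('a \<Rightarrow> 'b) \<Rightarrow> bool"
where
  "cdga_quasi_iso A B f \<longleftrightarrow> cdga_morphism A B f \<and> iso_on_cohomology A B f"

text \<open>
  Morphisms of cdga's connected by quasi-isomorphisms: there is a finite zigzag \<open>Z\<close> of commutative
  squares with quasi-isomorphisms as horizontal maps. As HOL does not quantify over types, the
  intermediate morphisms in \<open>Z\<close> all live in two ambient types \<open>'u\<close>, \<open>'v\<close>; this is no restriction,
  since finitely many vector spaces embed in a common one and these types may be chosen freely.
\<close>

type_synonym ('a, 'b) cdga_arrow = "'a dgalgebra \<times> 'b dgalgebra \<times> ('a \<Rightarrow> 'b)"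

fun square_quasi_iso ::
  "('a::ab_group_add, 'b::ab_group_add) cdga_arrow \<Rightarrow> ('c::ab_group_add, 'd::ab_group_add) cdga_arrow \<Rightarrow> bool"
where
  "square_quasi_iso (A, B, f) (C, D, g) \<longleftrightarrow>
     cdga_morphism A B f \<and> cdga_morphism C D g \<and>
     (\<exists>u v. cdga_quasi_iso A C u \<and> cdga_quasi_iso B D v \<and> (\<forall>a \<in> total A. v (f a) = g (u a)))"

definition linked ::
  "('a::ab_group_add, 'b::ab_group_add) cdga_arrow \<Rightarrow> ('c::ab_group_add, 'd::ab_group_add) cdga_arrow \<Rightarrow> bool"
where
  "linked X Y \<longleftrightarrow> square_quasi_iso X Y \<or> square_quasi_iso Y X"

definition connected_by_quasi_isos ::
  "('u::ab_group_add, 'v::ab_group_add) cdga_arrow list \<Rightarrow>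
   ('a::ab_group_add, 'b::ab_group_add) cdga_arrow \<Rightarrow> ('c::ab_group_add, 'd::ab_group_add) cdga_arrow \<Rightarrow> bool"
where
  "connected_by_quasi_isos Z X Y \<longleftrightarrow>
     Z \<noteq> [] \<and> linked X (hd Z) \<and> successively linked Z \<and> linked (last Z) Y"

section \<open>Piecewise linear forms\<close>

text \<open>
  The cdga of polynomial forms on the \<open>p\<close>-simplex is the free graded commutative algebra on
  \<open>t\<^sub>0, \<dots>, t\<^sub>p, dt\<^sub>0, \<dots>, dt\<^sub>p\<close> modulo \<open>t\<^sub>0 + \<dots> + t\<^sub>p = 1\<close> and \<open>dt\<^sub>0 + \<dots> + dt\<^sub>p = 0\<close>. Eliminating \<open>t\<^sub>0\<close> and
  \<open>dt\<^sub>0\<close>, a form is the sum over \<open>I \<subseteq> {1..p}\<close> of \<open>\<omega> I\<close> times the increasing product of the \<open>dt\<^sub>i\<close>,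
  \<open>i \<in> I\<close>, where \<open>\<omega> I\<close> is a rational polynomial in \<open>t\<^sub>1, \<dots>, t\<^sub>p\<close>.
\<close>

type_synonym qpoly = "(nat \<Rightarrow>\<^sub>0 nat) \<Rightarrow>\<^sub>0 rat"
type_synonym pl_form = "nat set \<Rightarrow> qpoly"

definition qconst :: "rat \<Rightarrow> qpoly" where
  "qconst c = Poly_Mapping.single 0 c"

definition qvar :: "nat \<Rightarrow> qpoly" where
  "qvar i = Poly_Mapping.single (Poly_Mapping.single i 1) 1"

definition qpoly_vars :: "qpoly \<Rightarrow> nat set" where
  "qpoly_vars P = (\<Union>e \<in> Poly_Mapping.keys P. Poly_Mapping.keys e)"

definition qpoly_partial :: "nat \<Rightarrow> qpoly \<Rightarrow> qpoly" where
  "qpoly_partial i P =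
     (\<Sum>e \<in> Poly_Mapping.keys P.
        Poly_Mapping.single (e - Poly_Mapping.single i 1)
          (Poly_Mapping.lookup P e * of_nat (Poly_Mapping.lookup e i)))"

definition qpoly_subst :: "(nat \<Rightarrow> qpoly) \<Rightarrow> qpoly \<Rightarrow> qpoly" where
  "qpoly_subst g P =
     (\<Sum>e \<in> Poly_Mapping.keys P.
        qconst (Poly_Mapping.lookup P e) * (\<Prod>i \<in> Poly_Mapping.keys e. g i ^ Poly_Mapping.lookup e i))"

definition pl_forms :: "nat \<Rightarrow> int \<Rightarrow> pl_form set" where
  "pl_forms p k =
     {\<omega>. \<forall>I. qpoly_vars (\<omega> I) \<subseteq> {1..p} \<and> (\<omega> I \<noteq> 0 \<longrightarrow> I \<subseteq> {1..p} \<and> int (card I) = k)}"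

definition form0 :: "qpoly \<Rightarrow> pl_form" where
  "form0 P = (\<lambda>I. if I = {} then P else 0)"

definition wedge :: "pl_form \<Rightarrow> pl_form \<Rightarrow> pl_form" where
  "wedge \<omega> \<eta> =
     (\<lambda>K. \<Sum>I \<in> Pow K. (-1) ^ card {(i, j). i \<in> I \<and> j \<in> K - I \<and> j < i} * \<omega> I * \<eta> (K - I))"

definition ext_deriv :: "pl_form \<Rightarrow> pl_form" where
  "ext_deriv \<omega> =
     (\<lambda>K. \<Sum>i \<in> K. (-1) ^ card {j \<in> K. j < i} * qpoly_partial i (\<omega> (K - {i})))"

definition bary :: "nat \<Rightarrow> nat \<Rightarrow> qpoly" where
  "bary q j = (if j = 0 then 1 - (\<Sum>i = 1..q. qvar i) else qvar j)"

text \<open>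
  A monotone map \<open>\<theta>\<close> from \<open>{..q}\<close> to \<open>{..p}\<close> acts on forms as the cdga morphism sending \<open>t\<^sub>i\<close> to
  \<open>pull_coord q \<theta> i\<close>, and on simplices by precomposition with the corresponding affine map.
\<close>

definition monotone_index :: "nat \<Rightarrow> nat \<Rightarrow> (nat \<Rightarrow> nat) \<Rightarrow> bool" where
  "monotone_index q p \<theta> \<longleftrightarrow> \<theta> ` {..q} \<subseteq> {..p} \<and> mono_on {..q} \<theta>"

definition pull_coord :: "nat \<Rightarrow> (nat \<Rightarrow> nat) \<Rightarrow> nat \<Rightarrow> qpoly" where
  "pull_coord q \<theta> i = (\<Sum>j | j \<le> q \<and> \<theta> j = i. bary q j)"

definition pull_form :: "nat \<Rightarrow> nat \<Rightarrow> (nat \<Rightarrow> nat) \<Rightarrow> pl_form \<Rightarrow> pl_form" where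
  "pull_form q p \<theta> \<omega> =
     (\<Sum>I \<in> Pow {1..p}.
        wedge (form0 (qpoly_subst (pull_coord q \<theta>) (\<omega> I)))
              (foldr wedge (map (\<lambda>i. ext_deriv (form0 (pull_coord q \<theta> i))) (sorted_list_of_set I)) (form0 1)))"

definition pull_simplex :: "nat \<Rightarrow> (nat \<Rightarrow> nat) \<Rightarrow> ((nat \<Rightarrow> real) \<Rightarrow> 's) \<Rightarrow> (nat \<Rightarrow> real) \<Rightarrow> 's" where
  "pull_simplex q \<theta> \<sigma> = restrict (\<lambda>x. \<sigma> (\<lambda>i. \<Sum>j | j \<le> q \<and> \<theta> j = i. x j)) (standard_simplex q)"

type_synonym 's pl_family = "nat \<Rightarrow> ((nat \<Rightarrow> real) \<Rightarrow> 's) \<Rightarrow> pl_form"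

text \<open>A form on \<open>X\<close> is a simplicial map from the singular simplices of \<open>X\<close> to polynomial forms.\<close>

definition A_PL :: "'s topology \<Rightarrow> 's pl_family dgalgebra" where
  "A_PL X = \<lparr>
     scl = (\<lambda>c \<omega> p \<sigma> I. qconst c * \<omega> p \<sigma> I),
     gr = (\<lambda>k. {\<omega>. \<forall>p \<sigma>.
        (if singular_simplex p X \<sigma>
         then \<omega> p \<sigma> \<in> pl_forms p k \<and>
              (\<forall>q \<theta>. monotone_index q p \<theta> \<longrightarrow> \<omega> q (pull_simplex q \<theta> \<sigma>) = pull_form q p \<theta> (\<omega> p \<sigma>))
         else \<omega> p \<sigma> = (\<lambda>_. 0))}),
     dif = (\<lambda>\<omega> p \<sigma>. ext_deriv (\<omega> p \<sigma>)),
     mul = (\<lambda>\<omega> \<eta> p \<sigma>. wedge (\<omega> p \<sigma>) (\<eta> p \<sigma>)),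
     uni = (\<lambda>p \<sigma>. if singular_simplex p X \<sigma> then form0 1 else (\<lambda>_. 0)) \<rparr>"

definition A_PL_map :: "'t topology \<Rightarrow> ('t \<Rightarrow> 's) \<Rightarrow> 's pl_family \<Rightarrow> 't pl_family" where
  "A_PL_map N e \<omega> =
     (\<lambda>p \<sigma>. if singular_simplex p N \<sigma> then \<omega> p (simplex_map p e \<sigma>) else (\<lambda>_. 0))"

text \<open>A cdga model of a continuous map \<open>e\<close> from \<open>N\<close> to \<open>M\<close>, witnessed by the zigzag \<open>Z\<close>.\<close>

definition cdga_model ::
  "('u::ab_group_add, 'v::ab_group_add) cdga_arrow list \<Rightarrow>
   'a::ab_group_add dgalgebra \<Rightarrow> 'b::ab_group_add dgalgebra \<Rightarrow> ('a \<Rightarrow> 'b) \<Rightarrow>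
   't topology \<Rightarrow> 's topology \<Rightarrow> ('t \<Rightarrow> 's) \<Rightarrow> bool"
where
  "cdga_model Z A B f N M e \<longleftrightarrow>
     cdga_morphism A B f \<and> connected_by_quasi_isos Z (A, B, f) (A_PL M, A_PL N, A_PL_map N e)"

section \<open>Oriented smooth manifolds\<close>

definition partial :: "nat \<Rightarrow> ((nat \<Rightarrow> real) \<Rightarrow> real) \<Rightarrow> (nat \<Rightarrow> real) \<Rightarrow> real" where
  "partial i F x = deriv (\<lambda>t. F (x(i := t))) (x i)"

definition iter_partial :: "nat list \<Rightarrow> ((nat \<Rightarrow> real) \<Rightarrow> real) \<Rightarrow> (nat \<Rightarrow> real) \<Rightarrow> real" where
  "iter_partial is F = foldr partial is F"

text \<open>
  Smoothness on an open subset \<open>U\<close> of \<open>Euclidean_space n\<close>: all iterated partial derivatives exist and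
  are continuous. Coordinates are numbered from \<open>0\<close>, and \<open>n = 0\<close> is allowed.
\<close>

definition smooth_fun :: "nat \<Rightarrow> (nat \<Rightarrow> real) set \<Rightarrow> ((nat \<Rightarrow> real) \<Rightarrow> real) \<Rightarrow> bool" where
  "smooth_fun n U F \<longleftrightarrow>
     (\<forall>is. set is \<subseteq> {..<n} \<longrightarrow>
        continuous_map (subtopology (Euclidean_space n) U) euclideanreal (iter_partial is F) \<and>
        (\<forall>i < n. \<forall>x \<in> U. (\<lambda>t. iter_partial is F (x(i := t))) differentiable (at (x i))))"

definition smooth_map ::
  "nat \<Rightarrow> nat \<Rightarrow> (nat \<Rightarrow> real) set \<Rightarrow> ((nat \<Rightarrow> real) \<Rightarrow> nat \<Rightarrow> real) \<Rightarrow> bool"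
where
  "smooth_map n k U F \<longleftrightarrow> (\<forall>j < k. smooth_fun n U (\<lambda>x. F x j))"

definition jacobian_det :: "nat \<Rightarrow> ((nat \<Rightarrow> real) \<Rightarrow> nat \<Rightarrow> real) \<Rightarrow> (nat \<Rightarrow> real) \<Rightarrow> real" where
  "jacobian_det n F x =
     (\<Sum>\<pi> | \<pi> permutes {..<n}. of_int (sign \<pi>) * (\<Prod>i<n. partial i (\<lambda>z. F z (\<pi> i)) x))"

type_synonym 's chart = "'s set \<times> ('s \<Rightarrow> nat \<Rightarrow> real)"

definition is_chart :: "nat \<Rightarrow> 's topology \<Rightarrow> 's chart \<Rightarrow> bool" where
  "is_chart n X = (\<lambda>(U, \<phi>).
     openin X U \<and> openin (Euclidean_space n) (\<phi> ` U) \<and>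
     homeomorphic_map (subtopology X U) (subtopology (Euclidean_space n) (\<phi> ` U)) \<phi>)"

definition oriented_smooth_atlas :: "nat \<Rightarrow> 's topology \<Rightarrow> 's chart set \<Rightarrow> bool" where
  "oriented_smooth_atlas n X \<A> \<longleftrightarrow>
     (\<forall>c \<in> \<A>. is_chart n X c) \<and>
     (\<Union>(U, \<phi>) \<in> \<A>. U) = topspace X \<and>
     (\<forall>(U, \<phi>) \<in> \<A>. \<forall>(V, \<psi>) \<in> \<A>.
        smooth_map n n (\<phi> ` (U \<inter> V)) (\<lambda>x. \<psi> (inv_into U \<phi> x)) \<and>
        (\<forall>x \<in> \<phi> ` (U \<inter> V). jacobian_det n (\<lambda>z. \<psi> (inv_into U \<phi> z)) x > 0))"

definition oriented_smooth_manifold :: "nat \<Rightarrow> 's topology \<Rightarrow> 's chart set \<Rightarrow> bool" where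
  "oriented_smooth_manifold n X \<A> \<longleftrightarrow>
     Hausdorff_space X \<and> second_countable X \<and> oriented_smooth_atlas n X \<A>"

definition simply_connected_space :: "'s topology \<Rightarrow> bool" where
  "simply_connected_space X \<longleftrightarrow>
     topspace X \<noteq> {} \<and> path_connected_space X \<and>
     (\<forall>g. pathin X g \<and> g 1 = g 0 \<longrightarrow>
        homotopic_with (\<lambda>h. h 0 = g 0 \<and> h 1 = g 0) (top_of_set {0..1}) X g (\<lambda>_. g 0))"

definition smooth_embedding ::
  "nat \<Rightarrow> 't topology \<Rightarrow> 't chart set \<Rightarrow> nat \<Rightarrow> 's topology \<Rightarrow> 's chart set \<Rightarrow> ('t \<Rightarrow> 's) \<Rightarrow> bool"
where
  "smooth_embedding n N \<A> m M \<B> e \<longleftrightarrow>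
     embedding_map N M e \<and>
     (\<forall>(U, \<phi>) \<in> \<A>. \<forall>(V, \<psi>) \<in> \<B>.
        let W = \<phi> ` {u \<in> U. e u \<in> V}; F = (\<lambda>x. \<psi> (e (inv_into U \<phi> x)))
        in smooth_map n m W F \<and>
           (\<forall>x \<in> W. \<forall>v. (\<forall>j < m. (\<Sum>i<n. partial i (\<lambda>z. F z j) x * v i) = 0) \<longrightarrow> (\<forall>i < n. v i = 0)))"

section \<open>Poincare duality algebras and shriek maps\<close>

definition poincare_duality_algebra :: "'a::ab_group_add dgalgebra \<Rightarrow> nat \<Rightarrow> ('a \<Rightarrow> rat) \<Rightarrow> bool" where
  "poincare_duality_algebra A n \<epsilon> \<longleftrightarrow>
     cdga A \<and>
     uni A \<noteq> 0 \<and> gr A 0 = qspan A {uni A} \<and>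
     (\<forall>k. \<exists>S. finite S \<and> gr A k = qspan A S) \<and>
     (\<forall>a \<in> total A. \<forall>b \<in> total A. \<epsilon> (a + b) = \<epsilon> a + \<epsilon> b) \<and>
     (\<forall>c. \<forall>a \<in> total A. \<epsilon> (scl A c a) = c * \<epsilon> a) \<and>
     (\<forall>k. k \<noteq> int n \<longrightarrow> (\<forall>a \<in> gr A k. \<epsilon> a = 0)) \<and>
     (\<forall>a \<in> gr A (int n - 1). \<epsilon> (dif A a) = 0) \<and>
     (\<forall>k. \<forall>a \<in> gr A k. (\<forall>b \<in> gr A (int n - k). \<epsilon> (mul A a b) = 0) \<longrightarrow> a = 0) \<and>
     (\<forall>k. \<forall>b \<in> gr A (int n - k). (\<forall>a \<in> gr A k. \<epsilon> (mul A a b) = 0) \<longrightarrow> b = 0)"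

text \<open>The duality isomorphism sends \<open>a\<close> to the functional \<open>z \<mapsto> \<epsilon> (a z)\<close>; this is its inverse.\<close>

definition duality_inv :: "'a::ab_group_add dgalgebra \<Rightarrow> ('a \<Rightarrow> rat) \<Rightarrow> ('a \<Rightarrow> rat) \<Rightarrow> 'a" where
  "duality_inv A \<epsilon> \<phi> = (THE a. a \<in> total A \<and> (\<forall>z \<in> total A. \<epsilon> (mul A a z) = \<phi> z))"

definition shriek ::
  "'a::ab_group_add dgalgebra \<Rightarrow> ('a \<Rightarrow> rat) \<Rightarrow> 'b::ab_group_add dgalgebra \<Rightarrow> ('b \<Rightarrow> rat) \<Rightarrow>
   ('a \<Rightarrow> 'b) \<Rightarrow> 'b \<Rightarrow> 'a"
where
  "shriek A \<epsilon>A B \<epsilon>B f b = duality_inv A \<epsilon>A (\<lambda>z. \<epsilon>B (mul B b (f z)))"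

definition dual_functional :: "('a::ab_group_add, 'z) dgspace_scheme \<Rightarrow> 'a set \<Rightarrow> 'a \<Rightarrow> 'a \<Rightarrow> rat" where
  "dual_functional A S x = (\<lambda>a. Modules.module.representation (scl A) S a x)"

section \<open>Hochschild cohomology\<close>

definition dg_bimodule :: "'a::ab_group_add dgalgebra \<Rightarrow> ('a, 'q::ab_group_add) dgbimodule \<Rightarrow> bool" where
  "dg_bimodule A Q \<longleftrightarrow>
     dg_space Q \<and> graded_bilinear A Q Q (lact Q) \<and> graded_bilinear Q A Q (ract Q) \<and>
     (\<forall>x \<in> total Q. lact Q (uni A) x = x \<and> ract Q x (uni A) = x) \<and>
     (\<forall>a \<in> total A. \<forall>b \<in> total A. \<forall>x \<in> total Q.
        lact Q (mul A a b) x = lact Q a (lact Q b x) \<and>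
        ract Q x (mul A a b) = ract Q (ract Q x a) b \<and>
        ract Q (lact Q a x) b = lact Q a (ract Q x b)) \<and>
     (\<forall>p. \<forall>a \<in> gr A p. \<forall>x \<in> total Q.
        dif Q (lact Q a x) = lact Q (dif A a) x + scl Q (koszul p) (lact Q a (dif Q x))) \<and>
     (\<forall>p. \<forall>x \<in> gr Q p. \<forall>a \<in> total A.
        dif Q (ract Q x a) = ract Q (dif Q x) a + scl Q (koszul p) (ract Q x (dif A a)))"

text \<open>The symmetric \<open>A\<close>-bimodule structure of \<open>B\<close> along a morphism \<open>f\<close> from \<open>A\<close> to \<open>B\<close>.\<close>

definition bimodule_along :: "'b dgalgebra \<Rightarrow> ('a \<Rightarrow> 'b) \<Rightarrow> ('a, 'b) dgbimodule" where
  "bimodule_along B f =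
     \<lparr> scl = scl B, gr = gr B, dif = dif B,
       lact = (\<lambda>a b. mul B (f a) b), ract = (\<lambda>b a. mul B b (f a)) \<rparr>"

abbreviation self_bimodule :: "'a dgalgebra \<Rightarrow> ('a, 'a) dgbimodule" where
  "self_bimodule A \<equiv> bimodule_along A (\<lambda>a. a)"

text \<open>
  Differential graded modules over \<open>A\<^sup>e = A \<otimes> A\<^sup>o\<^sup>p\<^sup>p\<close> are dg \<open>A\<close>-bimodules, with
  \<open>(a \<otimes> b) x = (-1)\<^bsup>|b||x|\<^esup> a x b\<close>. As \<open>A\<^sup>e\<close> has linear basis \<open>b \<otimes> b'\<close> with \<open>b\<close>, \<open>b'\<close> in a basis \<open>S\<close>
  of \<open>A\<close>, a family \<open>E\<close> is a basis of \<open>P\<close> over \<open>A\<^sup>e\<close> iff the elements \<open>b e b'\<close> form a linear basis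
  of \<open>P\<close>. In a semifree module the basis is filtered by sets \<open>E k\<close> such that the differential maps
  \<open>E k\<close> into the submodule generated by the earlier ones.
\<close>

definition semifree_bimodule :: "'a::ab_group_add dgalgebra \<Rightarrow> ('a, 'p::ab_group_add) dgbimodule \<Rightarrow> bool" where
  "semifree_bimodule A P \<longleftrightarrow>
     dg_bimodule A P \<and>
     (\<exists>(E :: nat \<Rightarrow> 'p set) S.
        disjoint_family E \<and> (\<Union>k. E k) \<subseteq> (\<Union>p. gr P p) \<and>
        homogeneous_basis A S \<and>
        inj_on (\<lambda>(b, e, b'). ract P (lact P b e) b') (S \<times> (\<Union>k. E k) \<times> S) \<and>
        homogeneous_basis P ((\<lambda>(b, e, b'). ract P (lact P b e) b') ` (S \<times> (\<Union>k. E k) \<times> S)) \<and>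
        (\<forall>k. \<forall>e \<in> E k. dif P e \<in>
           qspan P {ract P (lact P a e') b | a e' b. a \<in> total A \<and> b \<in> total A \<and> (\<exists>j < k. e' \<in> E j)}))"

definition semifree_resolution ::
  "'a::ab_group_add dgalgebra \<Rightarrow> ('a, 'p::ab_group_add) dgbimodule \<Rightarrow> ('p \<Rightarrow> 'a) \<Rightarrow> bool"
where
  "semifree_resolution A P \<rho> \<longleftrightarrow>
     semifree_bimodule A P \<and> graded_linear P A 0 \<rho> \<and>
     (\<forall>a \<in> total A. \<forall>x \<in> total P. \<rho> (lact P a x) = mul A a (\<rho> x) \<and> \<rho> (ract P x a) = mul A (\<rho> x) a) \<and>
     (\<forall>x \<in> total P. \<rho> (dif P x) = dif A (\<rho> x)) \<and>
     iso_on_cohomology P A \<rho>"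

text \<open>
  The degree \<open>k\<close> part of \<open>Hom\<close> over \<open>A\<^sup>e\<close> from \<open>P\<close> to \<open>Q\<close>, normalized to vanish outside of the carrier.
\<close>

definition hom_cochains ::
  "'a::ab_group_add dgalgebra \<Rightarrow> ('a, 'p::ab_group_add) dgbimodule \<Rightarrow> ('a, 'q::ab_group_add) dgbimodule \<Rightarrow>
   int \<Rightarrow> ('p \<Rightarrow> 'q) set"
where
  "hom_cochains A P Q k =
     {\<phi>. graded_linear P Q k \<phi> \<and> (\<forall>x. x \<notin> total P \<longrightarrow> \<phi> x = 0) \<and>
         (\<forall>p. \<forall>a \<in> gr A p. \<forall>x \<in> total P. \<phi> (lact P a x) = scl Q (koszul (k * p)) (lact Q a (\<phi> x))) \<and>
         (\<forall>a \<in> total A. \<forall>x \<in> total P. \<phi> (ract P x a) = ract Q (\<phi> x) a)}"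

definition hom_diff ::
  "('a, 'p::ab_group_add) dgbimodule \<Rightarrow> ('a, 'q::ab_group_add) dgbimodule \<Rightarrow> int \<Rightarrow> ('p \<Rightarrow> 'q) \<Rightarrow> 'p \<Rightarrow> 'q"
where
  "hom_diff P Q k \<phi> =
     (\<lambda>x. if x \<in> total P then dif Q (\<phi> x) - scl Q (koszul k) (\<phi> (dif P x)) else 0)"

definition hom_cocycles ::
  "'a::ab_group_add dgalgebra \<Rightarrow> ('a, 'p::ab_group_add) dgbimodule \<Rightarrow> ('a, 'q::ab_group_add) dgbimodule \<Rightarrow>
   int \<Rightarrow> ('p \<Rightarrow> 'q) set"
where
  "hom_cocycles A P Q k = {\<phi> \<in> hom_cochains A P Q k. hom_diff P Q k \<phi> = (\<lambda>_. 0)}"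

definition hom_coboundaries ::
  "'a::ab_group_add dgalgebra \<Rightarrow> ('a, 'p::ab_group_add) dgbimodule \<Rightarrow> ('a, 'q::ab_group_add) dgbimodule \<Rightarrow>
   int \<Rightarrow> ('p \<Rightarrow> 'q) set"
where
  "hom_coboundaries A P Q k = hom_diff P Q (k - 1) ` hom_cochains A P Q (k - 1)"

text \<open>
  \<open>HH A P Q k\<close> is \<open>Ext\<^bsup>k\<^esup>(A, Q)\<close> over \<open>A\<^sup>e\<close>, computed from a semifree resolution \<open>P\<close> of \<open>A\<close>.
\<close>

abbreviation HH_class ::
  "'a::ab_group_add dgalgebra \<Rightarrow> ('a, 'p::ab_group_add) dgbimodule \<Rightarrow> ('a, 'q::ab_group_add) dgbimodule \<Rightarrow>
   int \<Rightarrow> ('p \<Rightarrow> 'q) \<Rightarrow> ('p \<Rightarrow> 'q) set"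
where
  "HH_class A P Q k \<equiv> coh_class (hom_cocycles A P Q k) (hom_coboundaries A P Q k)"

definition HH ::
  "'a::ab_group_add dgalgebra \<Rightarrow> ('a, 'p::ab_group_add) dgbimodule \<Rightarrow> ('a, 'q::ab_group_add) dgbimodule \<Rightarrow>
   int \<Rightarrow> ('p \<Rightarrow> 'q) set set"
where
  "HH A P Q k = coh_space (hom_cocycles A P Q k) (hom_coboundaries A P Q k)"

text \<open>
  The map induced by composing cochains with an \<open>A\<close>-linear map \<open>g\<close> from \<open>Q\<close> to \<open>R\<close> of degree \<open>d\<close>;
  it takes \<open>HH A P Q k\<close> to \<open>HH A P R (k + d)\<close>.
\<close>

definition HH_map ::
  "'a::ab_group_add dgalgebra \<Rightarrow> ('a, 'p::ab_group_add) dgbimodule \<Rightarrow> ('a, 'r::ab_group_add) dgbimodule \<Rightarrow>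
   int \<Rightarrow> int \<Rightarrow> ('q \<Rightarrow> 'r) \<Rightarrow> ('p \<Rightarrow> 'q) set \<Rightarrow> ('p \<Rightarrow> 'r) set"
where
  "HH_map A P R k d g c = the_elem ((\<lambda>\<phi>. HH_class A P R (k + d) (g \<circ> \<phi>)) ` c)"

text \<open>The action of a class \<open>h\<close> in \<open>H\<^bsup>d\<^esup>(A)\<close> on \<open>HH A P Q k\<close> through the coefficients.\<close>

definition HH_mult ::
  "'a::ab_group_add dgalgebra \<Rightarrow> ('a, 'p::ab_group_add) dgbimodule \<Rightarrow> ('a, 'q::ab_group_add) dgbimodule \<Rightarrow>
   int \<Rightarrow> int \<Rightarrow> 'a set \<Rightarrow> ('p \<Rightarrow> 'q) set \<Rightarrow> ('p \<Rightarrow> 'q) set"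
where
  "HH_mult A P Q k d h c =
     the_elem ((\<lambda>(a, \<phi>). HH_class A P Q (k + d) (\<lambda>x. lact Q a (\<phi> x))) ` (h \<times> c))"

end

theory Submission
  imports Defs
begin

text \<open>
  Write \<open>d = m - n\<close>, and let \<open>\<alpha>\<close> be the element of \<open>A\<close> that represents the functional
  \<open>\<epsilon>\<^sub>B \<circ> f\<close> under the duality pairing \<open>(a, z) \<mapsto> \<epsilon>\<^sub>A (a z)\<close>; this is \<open>x\<^sup>*\<close>. The whole argument rests on the
  identity
    \<open>\<epsilon>\<^sub>A (\<alpha> a z) = \<epsilon>\<^sub>B (f (a z)) = \<epsilon>\<^sub>B (f a \<cdot> f z)\<close>,
  which says that \<open>\<alpha> a\<close> represents the functional defining \<open>f\<^sub>! (f a)\<close>. Hence \<open>f\<^sub>! \<circ> f\<close> is left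
  multiplication by \<open>\<alpha>\<close>, without any sign, already on the level of coefficients, and so the two
  sides of the theorem are the classes of the same cochain.

  What remains is that all operations descend to cohomology. Composing cochains with a morphism
  of dg bimodules of degree \<open>d\<close> (a map that commutes with the right action, and up to the Koszul
  sign with the left action and the differential) sends cocycles to cocycles and coboundaries to coboundaries
  (\<open>HH_map_class\<close>). Left multiplication by a cocycle is such a morphism by graded commutativity, and
  changing the cocycle by a coboundary \<open>d\<beta>\<close> changes the cochain \<open>\<alpha>\<phi>\<close> by the coboundary of \<open>\<beta>\<phi>\<close>
  (\<open>HH_mult_class\<close>). Because \<open>f\<close> is surjective, \<open>f\<^sub>!\<close> inherits all its properties from
  \<open>f\<^sub>! \<circ> f = \<alpha> \<cdot> _\<close> (\<open>dg_morphism_factor\<close>).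

  The element \<open>\<alpha>\<close> exists in degree \<open>d\<close> because a non-degenerate pairing with a finite dimensional
  space represents every functional on it (\<open>duality_representation\<close>), and it is a cocycle because
  \<open>\<epsilon>\<^sub>A\<close> and \<open>\<epsilon>\<^sub>B\<close> vanish on coboundaries (\<open>dif_eq_0_if_orthogonal\<close>).
\<close>

section \<open>Graded linear algebra\<close>

lemma koszul_0 [simp]: "koszul 0 = 1"
  by (simp add: koszul_def)

lemma koszul_add: "koszul (p + q) = koszul p * koszul q"
  by (auto simp: koszul_def)

lemma koszul_square [simp]: "koszul p * koszul p = 1"
  by (auto simp: koszul_def)

context
  fixes X :: "('a::ab_group_add, 'z) dgspace_scheme"
  assumes X: "dg_space X"
begin

lemma scl_vector_space: "vector_space (scl X)"
  using X by (simp add: dg_space_def)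

interpretation vector_space "scl X"
  by (rule scl_vector_space)

lemma scl_rules:
  "scl X c (x + y) = scl X c x + scl X c y" "scl X c (x - y) = scl X c x - scl X c y"
  "scl X (b + c) x = scl X b x + scl X c x" "scl X b (scl X c x) = scl X (b * c) x"
  "scl X 1 x = x" "scl X c 0 = 0"
  by (simp_all add: scale_right_distrib scale_right_diff_distrib scale_left_distrib)

lemma gr_subspace: "subspace (gr X p)"
  using X by (simp add: dg_space_def)

lemma total_subspace: "subspace (total X)"
  by (simp add: total_def qspan_def)

lemma gr_total: "x \<in> gr X p \<Longrightarrow> x \<in> total X"
  unfolding total_def qspan_def by (rule span_base) auto

lemma gr_0: "0 \<in> gr X p"
  and gr_add: "x \<in> gr X p \<Longrightarrow> y \<in> gr X p \<Longrightarrow> x + y \<in> gr X p"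
  and gr_diff: "x \<in> gr X p \<Longrightarrow> y \<in> gr X p \<Longrightarrow> x - y \<in> gr X p"
  and gr_scl: "x \<in> gr X p \<Longrightarrow> scl X c x \<in> gr X p"
  using gr_subspace by (auto intro: subspace_0 subspace_add subspace_diff subspace_scale)

lemma total_0: "0 \<in> total X"
  and total_add: "x \<in> total X \<Longrightarrow> y \<in> total X \<Longrightarrow> x + y \<in> total X"
  and total_diff: "x \<in> total X \<Longrightarrow> y \<in> total X \<Longrightarrow> x - y \<in> total X"
  and total_scl: "x \<in> total X \<Longrightarrow> scl X c x \<in> total X"
  using total_subspace by (auto intro: subspace_0 subspace_add subspace_diff subspace_scale)

lemma dif_total: "x \<in> total X \<Longrightarrow> dif X x \<in> total X"
  and dif_gr: "x \<in> gr X p \<Longrightarrow> dif X x \<in> gr X (p + 1)"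
  and dif_add: "x \<in> total X \<Longrightarrow> y \<in> total X \<Longrightarrow> dif X (x + y) = dif X x + dif X y"
  and dif_scl: "x \<in> total X \<Longrightarrow> dif X (scl X c x) = scl X c (dif X x)"
proof -
  have "linear_on_total X X (dif X)" "\<forall>p. \<forall>x \<in> gr X p. dif X x \<in> gr X (p + 1)"
    using X unfolding dg_space_def graded_linear_def by blast+
  then show "x \<in> total X \<Longrightarrow> dif X x \<in> total X" "x \<in> gr X p \<Longrightarrow> dif X x \<in> gr X (p + 1)"
    "x \<in> total X \<Longrightarrow> y \<in> total X \<Longrightarrow> dif X (x + y) = dif X x + dif X y"
    "x \<in> total X \<Longrightarrow> dif X (scl X c x) = scl X c (dif X x)"
    unfolding linear_on_total_def by blast+
qed

end

lemma total_induct [consumes 2, case_names zero homogeneous add]: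
  assumes X: "dg_space X" and x: "x \<in> total X" and "Q 0" and "\<And>p x. x \<in> gr X p \<Longrightarrow> Q x"
    and "\<And>x y. x \<in> total X \<Longrightarrow> y \<in> total X \<Longrightarrow> Q x \<Longrightarrow> Q y \<Longrightarrow> Q (x + y)"
  shows "Q x"
proof -
  interpret vector_space "scl X"
    by (rule scl_vector_space [OF X])
  have "x \<in> span (\<Union>p. gr X p)"
    using x by (simp add: total_def qspan_def)
  then have "x \<in> total X \<and> Q x"
  proof (induction rule: span_induct_alt)
    case base
    then show ?case using total_0 [OF X] assms(3) by simp
  next
    case (step c x y)
    then obtain p where "scl X c x \<in> gr X p"
      using gr_scl [OF X] by blast
    then show ?case
      using step assms(4,5) gr_total [OF X] total_add [OF X] by blast
  qed
  then show ?thesis ..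
qed

lemma homogeneous_decomposition:
  assumes X: "dg_space X" and x: "x \<in> total X"
  obtains F h where "finite F" "\<And>p. h p \<in> gr X p" "\<And>p. p \<notin> F \<Longrightarrow> h p = 0" "x = sum h F"
proof -
  have "\<exists>F h. finite F \<and> (\<forall>p. h p \<in> gr X p) \<and> (\<forall>p. p \<notin> F \<longrightarrow> h p = 0) \<and> x = sum h F"
    using X x
  proof (induction rule: total_induct)
    case zero
    show ?case
      by (rule exI [of _ "{}"], rule exI [of _ "\<lambda>_. 0"]) (simp add: gr_0 [OF X])
  next
    case (homogeneous p x)
    then show ?case
      by (intro exI [of _ "{p}"] exI [of _ "\<lambda>q. if q = p then x else 0"]) (simp add: gr_0 [OF X])
  next
    case (add x y)
    then obtain F h G g where
      F: "finite F" "\<forall>p. h p \<in> gr X p" "\<forall>p. p \<notin> F \<longrightarrow> h p = 0" "x = sum h F" and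
      G: "finite G" "\<forall>p. g p \<in> gr X p" "\<forall>p. p \<notin> G \<longrightarrow> g p = 0" "y = sum g G"
      by blast
    have "x = sum h (F \<union> G)" "y = sum g (F \<union> G)"
      unfolding F(4) G(4) using F G by (auto intro!: sum.mono_neutral_left)
    then have "x + y = (\<Sum>p\<in>F \<union> G. h p + g p)"
      by (simp add: sum.distrib)
    then show ?case
      using F G by (intro exI [of _ "F \<union> G"] exI [of _ "\<lambda>p. h p + g p"]) (simp add: gr_add [OF X])
  qed
  then show thesis using that by blast
qed

lemma homogeneous_independent:
  assumes "dg_space X" "finite F" "\<And>p. p \<in> F \<Longrightarrow> h p \<in> gr X p" "sum h F = 0" "p \<in> F"
  shows "h p = 0"
  using assms unfolding dg_space_def by blast

lemma linear_on_total_0: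
  assumes "dg_space X" "dg_space Y" "linear_on_total X Y g"
  shows "g 0 = 0"
proof -
  have "g (0 + 0) = g 0 + g 0"
    using assms total_0 [of X] unfolding linear_on_total_def by blast
  then show ?thesis by simp
qed

lemma linear_on_total_diff:
  assumes "dg_space X" "linear_on_total X Y g" "x \<in> total X" "y \<in> total X"
  shows "g (x - y) = g x - g y"
proof -
  have "g ((x - y) + y) = g (x - y) + g y"
    using assms total_diff [of X] unfolding linear_on_total_def by blast
  then show ?thesis by simp
qed

lemma linear_on_total_sum:
  assumes "dg_space X" "dg_space Y" "linear_on_total X Y g" "finite F" "\<And>p. p \<in> F \<Longrightarrow> h p \<in> total X"
  shows "sum h F \<in> total X \<and> g (sum h F) = (\<Sum>p\<in>F. g (h p))"
  using assms(4,5)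
proof (induction F rule: finite_induct)
  case empty
  then show ?case
    using linear_on_total_0 [OF assms(1-3)] total_0 [OF assms(1)] by simp
next
  case (insert p F)
  then have "g (h p + sum h F) = g (h p) + g (sum h F)"
    using assms(3) unfolding linear_on_total_def by blast
  then show ?case
    using insert total_add [OF assms(1)] by simp
qed

text \<open>
  Of any preimage of \<open>b\<close> only the component of degree \<open>p\<close> contributes: the images of the others
  lie in other degrees, so they vanish because the sum of the degrees is direct.
\<close>

lemma homogeneous_preimage:
  assumes X: "dg_space X" and Y: "dg_space Y" and g: "graded_linear X Y 0 g"
    and onto: "g ` total X = total Y" and b: "b \<in> gr Y p"
  obtains a where "a \<in> gr X p" "g a = b"
proof -
  have lin: "linear_on_total X Y g"
    using g by (simp add: graded_linear_def)
  have deg: "g a \<in> gr Y q" if "a \<in> gr X q" for a q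
    using g that unfolding graded_linear_def by fastforce
  have "b \<in> g ` total X"
    using gr_total [OF Y b] by (simp add: onto)
  then obtain a where a: "a \<in> total X" "g a = b" by blast
  obtain F h where h: "finite F" "\<And>q. h q \<in> gr X q" "\<And>q. q \<notin> F \<Longrightarrow> h q = 0" "a = sum h F"
    using homogeneous_decomposition [OF X a(1)] by blast
  have "sum h (insert p F) = a"
    unfolding h(4) using h by (intro sum.mono_neutral_right) auto
  then have "b = (\<Sum>q\<in>insert p F. g (h q))"
    using linear_on_total_sum [OF X Y lin, of "insert p F" h] h gr_total [OF X] a(2) by fastforce
  then have "(\<Sum>q\<in>insert p F. g (h q) - (if q = p then b else 0)) = 0"
    using h(1) by (simp add: sum_subtractf)
  then have "g (h p) - (if p = p then b else 0) = 0"
  proof (rule homogeneous_independent [OF Y, rotated 2])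
    show "g (h q) - (if q = p then b else 0) \<in> gr Y q" for q
      using deg h(2) b by (auto intro: gr_diff [OF Y])
  qed (use h(1) in auto)
  then show thesis
    using that [OF h(2)] by simp
qed

section \<open>Poincare duality\<close>

text \<open>
  For a pairing that separates the points of \<open>W\<close>, independent vectors of \<open>W\<close> can be given arbitrary
  values by pairing with some \<open>v \<in> V\<close>. In the induction step a new vector \<open>w\<close> needs an element of \<open>V\<close>
  that kills the old vectors but not \<open>w\<close>. If there were none, subtracting from any \<open>v\<close> its projection
  to the dual system of the old vectors would show that \<open>w\<close> pairs like a combination of the old
  vectors, hence is one.
\<close>

lemma prescribed_pairing_values:
  fixes sV :: "'k::field \<Rightarrow> 'v::ab_group_add \<Rightarrow> 'v" and sW :: "'k \<Rightarrow> 'w::ab_group_add \<Rightarrow> 'w"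
    and \<beta> :: "'v \<Rightarrow> 'w \<Rightarrow> 'k"
  assumes "vector_space sV" "vector_space sW"
    and V: "module.subspace sV V" and W: "module.subspace sW W"
    and addV: "\<And>v v' w. v \<in> V \<Longrightarrow> v' \<in> V \<Longrightarrow> w \<in> W \<Longrightarrow> \<beta> (v + v') w = \<beta> v w + \<beta> v' w"
    and sclV: "\<And>c v w. v \<in> V \<Longrightarrow> w \<in> W \<Longrightarrow> \<beta> (sV c v) w = c * \<beta> v w"
    and addW: "\<And>v w w'. v \<in> V \<Longrightarrow> w \<in> W \<Longrightarrow> w' \<in> W \<Longrightarrow> \<beta> v (w + w') = \<beta> v w + \<beta> v w'"
    and sclW: "\<And>c v w. v \<in> V \<Longrightarrow> w \<in> W \<Longrightarrow> \<beta> v (sW c w) = c * \<beta> v w"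
    and separating: "\<And>w. w \<in> W \<Longrightarrow> (\<And>v. v \<in> V \<Longrightarrow> \<beta> v w = 0) \<Longrightarrow> w = 0"
    and S: "finite S" "S \<subseteq> W" "\<not> module.dependent sW S"
  shows "\<exists>v\<in>V. \<forall>s\<in>S. \<beta> v s = g s"
proof -
  interpret V: vector_space sV by fact
  interpret W: vector_space sW by fact
  have zeroV: "\<beta> 0 w = 0" if "w \<in> W" for w
    using sclV [of 0 w 0] V.subspace_0 [OF V] that by simp
  have zeroW: "\<beta> v 0 = 0" if "v \<in> V" for v
    using sclW [of v 0 0] W.subspace_0 [OF W] that by simp
  have sumV: "\<beta> (\<Sum>t\<in>T. sV (c t) (u t)) w = (\<Sum>t\<in>T. c t * \<beta> (u t) w)"
    if "finite T" "\<And>t. t \<in> T \<Longrightarrow> u t \<in> V" "w \<in> W" for T w and c :: "'w \<Rightarrow> 'k" and u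
    using that
    by (induction T rule: finite_induct)
      (simp_all add: zeroV addV sclV V V.subspace_scale V.subspace_sum)
  have sumW: "\<beta> v (\<Sum>t\<in>T. sW (c t) t) = (\<Sum>t\<in>T. c t * \<beta> v t)"
    if "finite T" "T \<subseteq> W" "v \<in> V" for T v and c :: "'w \<Rightarrow> 'k"
    using that
    by (induction T rule: finite_induct)
      (simp_all add: zeroW addW sclW W W.subspace_scale W.subspace_sum subset_iff)
  show ?thesis
    using S
  proof (induction S arbitrary: g rule: finite_induct)
    case empty
    then show ?case using V.subspace_0 [OF V] by auto
  next
    case (insert w S)
    then have w: "w \<in> W" "S \<subseteq> W" "w \<notin> W.span S" "\<not> W.dependent S"
      by (simp_all add: W.independent_insert)
    have IH: "\<exists>v\<in>V. \<forall>s\<in>S. \<beta> v s = g s" for g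
      using insert.IH w by blast
    have "\<exists>v\<in>V. (\<forall>s\<in>S. \<beta> v s = 0) \<and> \<beta> v w \<noteq> 0"
    proof (rule ccontr)
      assume none: "\<not> ?thesis"
      have "\<forall>s. \<exists>v. v \<in> V \<and> (\<forall>t\<in>S. \<beta> v t = (if t = s then 1 else 0))"
        using IH [of "\<lambda>t. if t = s then 1 else 0" for s] by blast
      then obtain u where u: "\<And>s. u s \<in> V" "\<And>s t. t \<in> S \<Longrightarrow> \<beta> (u s) t = (if t = s then 1 else 0)"
        by metis
      let ?w = "\<Sum>s\<in>S. sW (\<beta> (u s) w) s"
      have wW: "?w \<in> W"
        using w by (intro W.subspace_sum [OF W] W.subspace_scale [OF W]) auto
      have "w - ?w = 0"
      proof (rule separating)
        show "w - ?w \<in> W"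
          using w wW by (intro W.subspace_diff [OF W])
        fix v assume v: "v \<in> V"
        let ?v = "\<Sum>s\<in>S. sV (\<beta> v s) (u s)"
        have vV: "?v \<in> V"
          using u by (intro V.subspace_sum [OF V] V.subspace_scale [OF V]) auto
        have diffV: "\<beta> (v - ?v) t = \<beta> v t - \<beta> ?v t" if "t \<in> W" for t
          using addV [of "v - ?v" ?v t] v vV that V.subspace_diff [OF V] by simp
        have "\<beta> (v - ?v) t = 0" if "t \<in> S" for t
        proof -
          have "\<beta> ?v t = (\<Sum>s\<in>S. \<beta> v s * (if t = s then 1 else 0))"
            using sumV [of S u t "\<beta> v"] u insert.hyps w that by auto
          then show ?thesis
            using diffV [of t] that w insert.hyps by (auto simp: if_distrib cong: if_cong)
        qed
        then have "\<beta> (v - ?v) w = 0"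
          using none v vV V.subspace_diff [OF V] by blast
        then have "\<beta> v w = \<beta> v ?w"
          using diffV [of w] sumV [of S u w "\<beta> v"] sumW [of S v "\<lambda>s. \<beta> (u s) w"] u insert.hyps w v
          by (simp add: mult.commute)
        then show "\<beta> v (w - ?w) = 0"
          using addW [of v "w - ?w" ?w] v w wW W.subspace_diff [OF W] by simp
      qed
      then have "w = ?w" by simp
      moreover have "?w \<in> W.span S"
        by (intro W.span_sum W.span_scale W.span_base)
      ultimately show False using w by simp
    qed
    then obtain v0 where v0: "v0 \<in> V" "\<forall>s\<in>S. \<beta> v0 s = 0" "\<beta> v0 w \<noteq> 0" by blast
    obtain v1 where v1: "v1 \<in> V" "\<forall>s\<in>S. \<beta> v1 s = g s" using IH by blast
    let ?c = "(g w - \<beta> v1 w) / \<beta> v0 w"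
    have "\<beta> (v1 + sV ?c v0) s = \<beta> v1 s + ?c * \<beta> v0 s" if "s \<in> W" for s
      using that v0 v1 by (simp add: addV sclV V.subspace_scale [OF V])
    then have "\<forall>s\<in>insert w S. \<beta> (v1 + sV ?c v0) s = g s"
      using v0 v1 w by auto
    moreover have "v1 + sV ?c v0 \<in> V"
      using v0 v1 by (intro V.subspace_add [OF V] V.subspace_scale [OF V])
    ultimately show ?case by blast
  qed
qed

context
  fixes A :: "'a::ab_group_add dgalgebra"
  assumes A: "cdga A"
begin

lemma cdga_dg_space: "dg_space A"
  using A unfolding cdga_def by blast

lemma mul_bilinear: "graded_bilinear A A A (mul A)"
  using A unfolding cdga_def by blast

lemma mul_linear_right: "a \<in> total A \<Longrightarrow> linear_on_total A A (mul A a)"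
  and mul_linear_left: "b \<in> total A \<Longrightarrow> linear_on_total A A (\<lambda>a. mul A a b)"
  and mul_gr: "a \<in> gr A p \<Longrightarrow> b \<in> gr A q \<Longrightarrow> mul A a b \<in> gr A (p + q)"
  using mul_bilinear unfolding graded_bilinear_def by blast+

lemma mul_total: "a \<in> total A \<Longrightarrow> b \<in> total A \<Longrightarrow> mul A a b \<in> total A"
  using mul_linear_right unfolding linear_on_total_def by blast

lemma mul_assoc:
  "a \<in> total A \<Longrightarrow> b \<in> total A \<Longrightarrow> c \<in> total A \<Longrightarrow> mul A (mul A a b) c = mul A a (mul A b c)"
  using A unfolding cdga_def by blast

lemma mul_uni: "a \<in> total A \<Longrightarrow> mul A (uni A) a = a" "a \<in> total A \<Longrightarrow> mul A a (uni A) = a"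
  using A unfolding cdga_def by blast+

lemma mul_graded_commute:
  "a \<in> gr A p \<Longrightarrow> b \<in> gr A q \<Longrightarrow> mul A a b = scl A (koszul (p * q)) (mul A b a)"
  using A unfolding cdga_def by blast

lemma leibniz:
  "a \<in> gr A p \<Longrightarrow> b \<in> total A \<Longrightarrow>
    dif A (mul A a b) = mul A (dif A a) b + scl A (koszul p) (mul A a (dif A b))"
  using A unfolding cdga_def by blast

lemma mul_graded_commute_total:
  assumes a: "a \<in> gr A p" and b: "b \<in> gr A q" and x: "x \<in> total A"
  shows "mul A a (mul A b x) = scl A (koszul (p * q)) (mul A b (mul A a x))"
proof -
  note T = gr_total [OF cdga_dg_space]
  have "mul A a (mul A b x) = mul A (scl A (koszul (p * q)) (mul A b a)) x"
    using mul_assoc [of a b x] mul_graded_commute [OF a b] T a b x by metis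
  also have "\<dots> = scl A (koszul (p * q)) (mul A (mul A b a) x)"
    using mul_linear_left [OF x] mul_total T a b unfolding linear_on_total_def by blast
  finally show ?thesis
    using mul_assoc [of b a x] T a b x by simp
qed

end

context
  fixes A :: "'a::ab_group_add dgalgebra" and n :: nat and \<epsilon> :: "'a \<Rightarrow> rat"
  assumes PD: "poincare_duality_algebra A n \<epsilon>"
begin

lemma PD_cdga: "cdga A"
  using PD unfolding poincare_duality_algebra_def by blast

lemma PD_dg_space: "dg_space A"
  using PD_cdga by (rule cdga_dg_space)

lemma orientation_add: "a \<in> total A \<Longrightarrow> b \<in> total A \<Longrightarrow> \<epsilon> (a + b) = \<epsilon> a + \<epsilon> b"
  and orientation_scl: "a \<in> total A \<Longrightarrow> \<epsilon> (scl A c a) = c * \<epsilon> a"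
  and orientation_degree: "a \<in> gr A k \<Longrightarrow> k \<noteq> int n \<Longrightarrow> \<epsilon> a = 0"
  using PD unfolding poincare_duality_algebra_def by blast+

lemma orientation_0: "\<epsilon> 0 = 0"
  using orientation_add [of 0 0] total_0 [OF PD_dg_space] by simp

lemma orientation_diff: "a \<in> total A \<Longrightarrow> b \<in> total A \<Longrightarrow> \<epsilon> (a - b) = \<epsilon> a - \<epsilon> b"
  using orientation_add [of "a - b" b] total_diff [OF PD_dg_space] by simp

lemma orientation_sum:
  assumes "finite F" "\<And>i. i \<in> F \<Longrightarrow> h i \<in> total A"
  shows "\<epsilon> (sum h F) = (\<Sum>i\<in>F. \<epsilon> (h i)) \<and> sum h F \<in> total A"
  using assms
  by (induction F rule: finite_induct)
    (simp_all add: orientation_0 orientation_add total_0 total_add PD_dg_space)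

lemma orientation_dif:
  assumes "a \<in> total A" shows "\<epsilon> (dif A a) = 0"
  using PD_dg_space assms
proof (induction rule: total_induct)
  case zero
  show ?case
    using dif_add [OF PD_dg_space, of 0 0] total_0 [OF PD_dg_space] orientation_0 by simp
next
  case (homogeneous p x)
  show ?case
  proof (cases "p + 1 = int n")
    case True
    then have "p = int n - 1" by simp
    then show ?thesis
      using PD homogeneous unfolding poincare_duality_algebra_def by blast
  next
    case False
    then show ?thesis
      using orientation_degree dif_gr [OF PD_dg_space homogeneous] by blast
  qed
next
  case (add x y)
  then show ?case
    by (simp add: dif_add [OF PD_dg_space] orientation_add dif_total [OF PD_dg_space])
qed

text \<open>
  Non-degeneracy is given degree by degree. Pairing with elements of degree \<open>n - p\<close> isolates the
  component of degree \<open>p\<close> of \<open>b\<close>, as \<open>\<epsilon>\<close> lives in degree \<open>n\<close>.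
\<close>

lemma pairing_separates_left:
  assumes b: "b \<in> total A" and orth: "\<And>z. z \<in> total A \<Longrightarrow> \<epsilon> (mul A b z) = 0"
  shows "b = 0"
proof -
  note T = gr_total [OF PD_dg_space] and M = mul_total [OF PD_cdga]
  obtain F h where h: "finite F" "\<And>q. h q \<in> gr A q" "b = sum h F"
    using homogeneous_decomposition [OF PD_dg_space b] by metis
  have "h p = 0" if p: "p \<in> F" for p
  proof -
    have "\<epsilon> (mul A (h p) z) = 0" if z: "z \<in> gr A (int n - p)" for z
    proof -
      have other: "\<epsilon> (mul A (h q) z) = 0" if "q \<noteq> p" for q
        using orientation_degree [OF mul_gr [OF PD_cdga h(2) z]] that by simp
      have "mul A b z = (\<Sum>q\<in>F. mul A (h q) z)"
        unfolding h(3)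
        using linear_on_total_sum [OF PD_dg_space PD_dg_space mul_linear_left [OF PD_cdga T [OF z]]
            h(1), of h] T [OF h(2)] by blast
      moreover have "\<epsilon> (\<Sum>q\<in>F. mul A (h q) z) = (\<Sum>q\<in>F. \<epsilon> (mul A (h q) z))"
        using orientation_sum [OF h(1), of "\<lambda>q. mul A (h q) z"] M [OF T [OF h(2)] T [OF z]] by blast
      ultimately have "0 = (\<Sum>q\<in>F. \<epsilon> (mul A (h q) z))"
        using orth [OF T [OF z]] by simp
      also have "\<dots> = (\<Sum>q\<in>F. if q = p then \<epsilon> (mul A (h p) z) else 0)"
        by (intro sum.cong refl) (simp add: other)
      finally show ?thesis
        using h(1) p by simp
    qed
    moreover have "\<forall>k. \<forall>a \<in> gr A k. (\<forall>b \<in> gr A (int n - k). \<epsilon> (mul A a b) = 0) \<longrightarrow> a = 0"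
      using PD unfolding poincare_duality_algebra_def by (elim conjE)
    ultimately show ?thesis
      using h(2) by blast
  qed
  then show ?thesis
    using h(3) by simp
qed

lemma duality_inv_eqI:
  assumes a: "a \<in> total A" and rep: "\<And>z. z \<in> total A \<Longrightarrow> \<epsilon> (mul A a z) = \<phi> z"
  shows "duality_inv A \<epsilon> \<phi> = a"
  unfolding duality_inv_def
proof (rule the_equality)
  show "a \<in> total A \<and> (\<forall>z\<in>total A. \<epsilon> (mul A a z) = \<phi> z)"
    using assms by blast
next
  fix b assume b: "b \<in> total A \<and> (\<forall>z\<in>total A. \<epsilon> (mul A b z) = \<phi> z)"
  have "b - a = 0"
  proof (rule pairing_separates_left)
    show "b - a \<in> total A"
      using a b total_diff [OF PD_dg_space] by blast
    fix z assume z: "z \<in> total A"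
    have "mul A (b - a) z = mul A b z - mul A a z"
      using linear_on_total_diff [OF PD_dg_space mul_linear_left [OF PD_cdga z]] a b by blast
    then show "\<epsilon> (mul A (b - a) z) = 0"
      using a b rep z mul_total [OF PD_cdga] by (simp add: orientation_diff)
  qed
  then show "b = a" by simp
qed

text \<open>
  The component of degree \<open>p\<close> has a finite basis, so some element of the complementary degree takes
  the values of the functional on that basis; in all other degrees both sides vanish.
\<close>

lemma duality_representation:
  assumes add: "\<And>y z. y \<in> total A \<Longrightarrow> z \<in> total A \<Longrightarrow> \<phi> (y + z) = \<phi> y + \<phi> z"
    and scl: "\<And>c z. z \<in> total A \<Longrightarrow> \<phi> (scl A c z) = c * \<phi> z"
    and degree: "\<And>q z. q \<noteq> p \<Longrightarrow> z \<in> gr A q \<Longrightarrow> \<phi> z = 0"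
  obtains a where "a \<in> gr A (int n - p)" "\<And>z. z \<in> total A \<Longrightarrow> \<epsilon> (mul A a z) = \<phi> z"
proof -
  note D = PD_dg_space and T = gr_total [OF PD_dg_space] and M = mul_total [OF PD_cdga]
  interpret vector_space "scl A"
    by (rule scl_vector_space [OF D])
  have lin: "linear_on_total A A (mul A a)" "linear_on_total A A (\<lambda>b. mul A b a)" if "a \<in> total A" for a
    using that mul_linear_right mul_linear_left PD_cdga by blast+
  obtain G where G: "finite G" "gr A p = span G"
    using PD unfolding poincare_duality_algebra_def qspan_def by blast
  obtain S where S: "S \<subseteq> gr A p" "independent S" "gr A p \<subseteq> span S"
    using maximal_independent_subset by blast
  have "finite S"
    using independent_span_bound [OF G(1) S(2)] S(1) G(2) by blast
  have "\<exists>a\<in>gr A (int n - p). \<forall>s\<in>S. \<epsilon> (mul A a s) = \<phi> s"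
  proof (rule prescribed_pairing_values [OF scl_vector_space [OF D] scl_vector_space [OF D]
        gr_subspace [OF D] gr_subspace [OF D] _ _ _ _ _ \<open>finite S\<close> S(1) S(2)])
    fix v v' w c assume v: "v \<in> gr A (int n - p)" "v' \<in> gr A (int n - p)" "w \<in> gr A p"
    have "mul A (v + v') w = mul A v w + mul A v' w"
      using lin(2) [OF T, OF v(3)] T v unfolding linear_on_total_def by blast
    then show "\<epsilon> (mul A (v + v') w) = \<epsilon> (mul A v w) + \<epsilon> (mul A v' w)"
      using v T M by (simp add: orientation_add)
  next
    fix v w c assume v: "v \<in> gr A (int n - p)" "w \<in> gr A p"
    have "mul A (scl A c v) w = scl A c (mul A v w)"
      using lin(2) [OF T, OF v(2)] T v unfolding linear_on_total_def by blast
    then show "\<epsilon> (mul A (scl A c v) w) = c * \<epsilon> (mul A v w)"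
      using v T M by (simp add: orientation_scl)
    have "mul A v (scl A c w) = scl A c (mul A v w)"
      using lin(1) [OF T, OF v(1)] T v unfolding linear_on_total_def by blast
    then show "\<epsilon> (mul A v (scl A c w)) = c * \<epsilon> (mul A v w)"
      using v T M by (simp add: orientation_scl)
  next
    fix v w w' assume v: "v \<in> gr A (int n - p)" "w \<in> gr A p" "w' \<in> gr A p"
    have "mul A v (w + w') = mul A v w + mul A v w'"
      using lin(1) [OF T, OF v(1)] T v unfolding linear_on_total_def by blast
    then show "\<epsilon> (mul A v (w + w')) = \<epsilon> (mul A v w) + \<epsilon> (mul A v w')"
      using v T M by (simp add: orientation_add)
  next
    fix w assume "w \<in> gr A p" "\<And>v. v \<in> gr A (int n - p) \<Longrightarrow> \<epsilon> (mul A v w) = 0"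
    moreover have "\<forall>k. \<forall>b \<in> gr A (int n - k). (\<forall>a \<in> gr A k. \<epsilon> (mul A a b) = 0) \<longrightarrow> b = 0"
      using PD unfolding poincare_duality_algebra_def by blast
    from this [rule_format, of w "int n - p"]
    have "w \<in> gr A p \<Longrightarrow> (\<And>v. v \<in> gr A (int n - p) \<Longrightarrow> \<epsilon> (mul A v w) = 0) \<Longrightarrow> w = 0"
      by simp
    ultimately show "w = 0" by blast
  qed
  then obtain a where a: "a \<in> gr A (int n - p)" "\<And>s. s \<in> S \<Longrightarrow> \<epsilon> (mul A a s) = \<phi> s" by blast
  have aT: "a \<in> total A" using T a(1) by blast
  have mul_zero: "mul A a 0 = 0"
    using linear_on_total_0 [OF D D lin(1) [OF aT]] .
  have phi_zero: "\<phi> 0 = 0"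
    using add [of 0 0] total_0 [OF D] by simp
  have mul_add: "mul A a (y + z) = mul A a y + mul A a z" if "y \<in> total A" "z \<in> total A" for y z
    using lin(1) [OF aT] that unfolding linear_on_total_def by blast
  have mul_scl: "mul A a (scl A c z) = scl A c (mul A a z)" if "z \<in> total A" for c z
    using lin(1) [OF aT] that unfolding linear_on_total_def by blast
  have rep_p: "\<epsilon> (mul A a z) = \<phi> z" if "z \<in> gr A p" for z
  proof -
    have "z \<in> span S" using that S(3) by blast
    then have "z \<in> total A \<and> \<epsilon> (mul A a z) = \<phi> z"
    proof (induction rule: span_induct_alt)
      case base
      show ?case
        using mul_zero phi_zero orientation_0 total_0 [OF D] by simp
    next
      case (step c s y)
      then have "s \<in> total A" using S(1) T by blast
      then show ?case
        using step a(2) M [OF aT]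
        by (simp add: total_add [OF D] total_scl [OF D] mul_add mul_scl add scl
            orientation_add orientation_scl)
    qed
    then show ?thesis ..
  qed
  have "\<epsilon> (mul A a z) = \<phi> z" if "z \<in> total A" for z
    using D that
  proof (induction rule: total_induct)
    case zero
    show ?case using mul_zero phi_zero orientation_0 by simp
  next
    case (homogeneous q z)
    show ?case
    proof (cases "q = p")
      case True
      then show ?thesis using rep_p homogeneous by blast
    next
      case False
      then show ?thesis
        using degree homogeneous orientation_degree [OF mul_gr [OF PD_cdga a(1) homogeneous]] by simp
    qed
  next
    case (add y z)
    then show ?case
      using M [OF aT] assms(1) by (simp add: mul_add orientation_add)
  qed
  then show thesis using that a(1) by blast
qed

text \<open>Integration by parts: \<open>\<epsilon> (da \<cdot> z) = \<plusminus> \<epsilon> (a \<cdot> dz)\<close> since \<open>\<epsilon>\<close> kills \<open>d (a z)\<close>.\<close>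

lemma dif_eq_0_if_orthogonal:
  assumes a: "a \<in> gr A p" and orth: "\<And>z. z \<in> total A \<Longrightarrow> \<epsilon> (mul A a (dif A z)) = 0"
  shows "dif A a = 0"
proof (rule pairing_separates_left)
  note D = PD_dg_space and T = gr_total [OF PD_dg_space] and M = mul_total [OF PD_cdga]
  show "dif A a \<in> total A"
    using T a dif_total [OF D] by blast
  fix z assume z: "z \<in> total A"
  have aT: "a \<in> total A" using T [OF a] .
  have "0 = \<epsilon> (dif A (mul A a z))"
    using orientation_dif [OF M [OF aT z]] by simp
  also have "\<dots> = \<epsilon> (mul A (dif A a) z) + koszul p * \<epsilon> (mul A a (dif A z))"
    unfolding leibniz [OF PD_cdga a z]
    using M [OF dif_total [OF D aT] z] M [OF aT dif_total [OF D z]]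
    by (simp add: orientation_add orientation_scl total_scl [OF D])
  also have "\<dots> = \<epsilon> (mul A (dif A a) z)"
    by (simp only: orth [OF z] mult_zero_right add_0_right)
  finally show "\<epsilon> (mul A (dif A a) z) = 0" by (rule sym)
qed

end

section \<open>Morphisms of bimodules and Hochschild cohomology\<close>

lemma bimodule_along_simps [simp]:
  "scl (bimodule_along B f) = scl B" "gr (bimodule_along B f) = gr B"
  "dif (bimodule_along B f) = dif B" "total (bimodule_along B f) = total B"
  "lact (bimodule_along B f) = (\<lambda>a b. mul B (f a) b)"
  "ract (bimodule_along B f) = (\<lambda>b a. mul B b (f a))"
  by (simp_all add: bimodule_along_def total_def qspan_def)

lemma dg_space_bimodule_along [simp]: "dg_space (bimodule_along B f) \<longleftrightarrow> dg_space B"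
  by (simp add: dg_space_def graded_linear_def linear_on_total_def)

lemma cdga_morphism_id: "cdga A \<Longrightarrow> cdga_morphism A A (\<lambda>a. a)"
  by (simp add: cdga_morphism_def graded_linear_def linear_on_total_def)

lemma dg_bimodule_along:
  assumes f: "cdga_morphism A B f"
  shows "dg_bimodule A (bimodule_along B f)"
proof -
  have A: "cdga A" and B: "cdga B" and lin: "linear_on_total A B f"
    and deg: "\<And>p a. a \<in> gr A p \<Longrightarrow> f a \<in> gr B p"
    and mul: "\<And>a b. a \<in> total A \<Longrightarrow> b \<in> total A \<Longrightarrow> f (mul A a b) = mul B (f a) (f b)"
    and uni: "f (uni A) = uni B" and dif: "\<And>a. a \<in> total A \<Longrightarrow> f (dif A a) = dif B (f a)"
    using f unfolding cdga_morphism_def graded_linear_def by simp_all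
  have tot: "f a \<in> total B" if "a \<in> total A" for a
    using lin that unfolding linear_on_total_def by blast
  note M = mul_total [OF B] and T = gr_total [OF cdga_dg_space [OF A]]
  have mul_right: "mul B b (x + y) = mul B b x + mul B b y" "mul B b (scl B c x) = scl B c (mul B b x)"
    and mul_left: "mul B (x + y) b = mul B x b + mul B y b" "mul B (scl B c x) b = scl B c (mul B x b)"
    if "b \<in> total B" "x \<in> total B" "y \<in> total B" for b x y c
    using mul_linear_right [OF B that(1)] mul_linear_left [OF B that(1)] that
    unfolding linear_on_total_def by blast+
  have f_lin: "f (x + y) = f x + f y" "f (scl A c x) = scl B c (f x)"
    if "x \<in> total A" "y \<in> total A" for x y c
    using lin that unfolding linear_on_total_def by blast+
  show ?thesis
    unfolding dg_bimodule_def graded_bilinear_def linear_on_total_def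
  proof (intro conjI ballI allI; simp)
    show "dg_space B" using B by (rule cdga_dg_space)
  next
    fix p x a assume x: "x \<in> gr B p" and "a \<in> total A"
    then show "dif B (mul B x (f a)) = mul B (dif B x) (f a) + scl B (koszul p) (mul B x (f (dif A a)))"
      using leibniz [OF B x] tot dif by simp
  next
    fix p a x assume a: "a \<in> gr A p" and "x \<in> total B"
    then show "dif B (mul B (f a) x) = mul B (f (dif A a)) x + scl B (koszul p) (mul B (f a) (dif B x))"
      using leibniz [OF B deg [OF a]] dif T by simp
  qed (use M tot in \<open>simp_all add: mul_right mul_left f_lin mul_gr [OF B] deg uni mul_uni [OF B]
        mul mul_assoc [OF B]\<close>)
qed

context
  fixes A :: "'a::ab_group_add dgalgebra" and Q :: "('a, 'q::ab_group_add) dgbimodule"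
  assumes Q: "dg_bimodule A Q"
begin

lemma bimodule_dg_space: "dg_space Q"
  using Q unfolding dg_bimodule_def by blast

lemma bimodule_linear:
  "a \<in> total A \<Longrightarrow> linear_on_total Q Q (lact Q a)"
  "a \<in> total A \<Longrightarrow> linear_on_total Q Q (\<lambda>x. ract Q x a)"
proof -
  have "graded_bilinear A Q Q (lact Q)" "graded_bilinear Q A Q (ract Q)"
    using Q unfolding dg_bimodule_def by blast+
  then show "a \<in> total A \<Longrightarrow> linear_on_total Q Q (lact Q a)"
    "a \<in> total A \<Longrightarrow> linear_on_total Q Q (\<lambda>x. ract Q x a)"
    unfolding graded_bilinear_def by blast+
qed

lemma bimodule_total:
  "a \<in> total A \<Longrightarrow> x \<in> total Q \<Longrightarrow> lact Q a x \<in> total Q"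
  "a \<in> total A \<Longrightarrow> x \<in> total Q \<Longrightarrow> ract Q x a \<in> total Q"
  using bimodule_linear unfolding linear_on_total_def by blast+

lemma bimodule_diff:
  "a \<in> total A \<Longrightarrow> x \<in> total Q \<Longrightarrow> y \<in> total Q \<Longrightarrow> lact Q a (x - y) = lact Q a x - lact Q a y"
  "a \<in> total A \<Longrightarrow> x \<in> total Q \<Longrightarrow> y \<in> total Q \<Longrightarrow> ract Q (x - y) a = ract Q x a - ract Q y a"
  using linear_on_total_diff [OF bimodule_dg_space bimodule_linear(1)]
    linear_on_total_diff [OF bimodule_dg_space bimodule_linear(2)] by blast+

lemma bimodule_scl:
  "a \<in> total A \<Longrightarrow> x \<in> total Q \<Longrightarrow> lact Q a (scl Q c x) = scl Q c (lact Q a x)"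
  "a \<in> total A \<Longrightarrow> x \<in> total Q \<Longrightarrow> ract Q (scl Q c x) a = scl Q c (ract Q x a)"
  using bimodule_linear unfolding linear_on_total_def by blast+

end

lemma hom_cochainsD:
  assumes "\<phi> \<in> hom_cochains A P Q k"
  shows "linear_on_total P Q \<phi>"
    and "x \<in> total P \<Longrightarrow> \<phi> x \<in> total Q"
    and "x \<in> gr P p \<Longrightarrow> \<phi> x \<in> gr Q (p + k)"
    and "x \<in> total P \<Longrightarrow> y \<in> total P \<Longrightarrow> \<phi> (x + y) = \<phi> x + \<phi> y"
    and "x \<in> total P \<Longrightarrow> \<phi> (scl P c x) = scl Q c (\<phi> x)"
    and "x \<notin> total P \<Longrightarrow> \<phi> x = 0"
    and "a \<in> gr A p \<Longrightarrow> x \<in> total P \<Longrightarrow> \<phi> (lact P a x) = scl Q (koszul (k * p)) (lact Q a (\<phi> x))"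
    and "a \<in> total A \<Longrightarrow> x \<in> total P \<Longrightarrow> \<phi> (ract P x a) = ract Q (\<phi> x) a"
  using assms unfolding hom_cochains_def graded_linear_def linear_on_total_def by blast+

lemma hom_cochainsI:
  assumes "\<And>x. x \<in> total P \<Longrightarrow> \<phi> x \<in> total Q"
    and "\<And>p x. x \<in> gr P p \<Longrightarrow> \<phi> x \<in> gr Q (p + k)"
    and "\<And>x y. x \<in> total P \<Longrightarrow> y \<in> total P \<Longrightarrow> \<phi> (x + y) = \<phi> x + \<phi> y"
    and "\<And>c x. x \<in> total P \<Longrightarrow> \<phi> (scl P c x) = scl Q c (\<phi> x)"
    and "\<And>x. x \<notin> total P \<Longrightarrow> \<phi> x = 0"
    and "\<And>p a x. a \<in> gr A p \<Longrightarrow> x \<in> total P \<Longrightarrow>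
          \<phi> (lact P a x) = scl Q (koszul (k * p)) (lact Q a (\<phi> x))"
    and "\<And>a x. a \<in> total A \<Longrightarrow> x \<in> total P \<Longrightarrow> \<phi> (ract P x a) = ract Q (\<phi> x) a"
  shows "\<phi> \<in> hom_cochains A P Q k"
  using assms unfolding hom_cochains_def graded_linear_def linear_on_total_def by blast

context
  fixes A :: "'a::ab_group_add dgalgebra" and P :: "('a, 'p::ab_group_add) dgbimodule"
    and Q :: "('a, 'q::ab_group_add) dgbimodule"
  assumes A: "dg_space A" and P: "dg_bimodule A P" and Q: "dg_bimodule A Q"
begin

lemma hom_cochains_diff:
  assumes \<phi>: "\<phi> \<in> hom_cochains A P Q k" and \<psi>: "\<psi> \<in> hom_cochains A P Q k"
  shows "\<phi> - \<psi> \<in> hom_cochains A P Q k"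
  using bimodule_dg_space [OF Q] hom_cochainsD [OF \<phi>] hom_cochainsD [OF \<psi>]
  by (intro hom_cochainsI)
    (simp_all add: total_diff gr_diff scl_rules bimodule_diff [OF Q] gr_total [OF A])

lemma hom_cochains_scl:
  assumes \<phi>: "\<phi> \<in> hom_cochains A P Q k"
  shows "(\<lambda>x. scl Q c (\<phi> x)) \<in> hom_cochains A P Q k"
  using bimodule_dg_space [OF Q] hom_cochainsD [OF \<phi>]
  by (intro hom_cochainsI)
    (simp_all add: total_scl gr_scl scl_rules bimodule_scl [OF Q] gr_total [OF A] mult.commute)

lemma hom_diff_diff:
  assumes \<phi>: "\<phi> \<in> hom_cochains A P Q k" and \<psi>: "\<psi> \<in> hom_cochains A P Q k"
  shows "hom_diff P Q k (\<phi> - \<psi>) = hom_diff P Q k \<phi> - hom_diff P Q k \<psi>"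
proof
  note DQ = bimodule_dg_space [OF Q]
  have "linear_on_total Q Q (dif Q)"
    using DQ unfolding dg_space_def graded_linear_def by blast
  note dif_diff = linear_on_total_diff [OF DQ this]
  show "hom_diff P Q k (\<phi> - \<psi>) x = (hom_diff P Q k \<phi> - hom_diff P Q k \<psi>) x" for x
    using hom_cochainsD(2) [OF \<phi>] hom_cochainsD(2) [OF \<psi>]
    by (simp add: hom_diff_def dif_diff scl_rules [OF DQ])
qed

lemma hom_coboundaries_diff:
  assumes "\<phi> \<in> hom_coboundaries A P Q k" "\<psi> \<in> hom_coboundaries A P Q k"
  shows "\<phi> - \<psi> \<in> hom_coboundaries A P Q k"
proof -
  obtain \<theta> \<xi> where "\<theta> \<in> hom_cochains A P Q (k - 1)" "\<xi> \<in> hom_cochains A P Q (k - 1)"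
    and "\<phi> = hom_diff P Q (k - 1) \<theta>" "\<psi> = hom_diff P Q (k - 1) \<xi>"
    using assms unfolding hom_coboundaries_def by blast
  then have "\<phi> - \<psi> = hom_diff P Q (k - 1) (\<theta> - \<xi>)" "\<theta> - \<xi> \<in> hom_cochains A P Q (k - 1)"
    by (simp_all add: hom_diff_diff hom_cochains_diff)
  then show ?thesis
    unfolding hom_coboundaries_def by (rule image_eqI)
qed

lemma HH_class_eqI:
  assumes diff: "\<phi> - \<psi> \<in> hom_coboundaries A P Q k"
  shows "HH_class A P Q k \<phi> = HH_class A P Q k \<psi>"
proof -
  let ?B = "hom_coboundaries A P Q k"
  have "0 \<in> ?B"
    using hom_coboundaries_diff [OF diff diff] by simp
  then have "0 - (\<phi> - \<psi>) \<in> ?B"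
    using diff by (rule hom_coboundaries_diff)
  have "\<theta> - \<phi> \<in> ?B \<longleftrightarrow> \<theta> - \<psi> \<in> ?B" for \<theta>
  proof
    assume "\<theta> - \<phi> \<in> ?B"
    then have "(\<theta> - \<phi>) - (0 - (\<phi> - \<psi>)) \<in> ?B"
      using \<open>0 - (\<phi> - \<psi>) \<in> ?B\<close> by (rule hom_coboundaries_diff)
    then show "\<theta> - \<psi> \<in> ?B" by simp
  next
    assume "\<theta> - \<psi> \<in> ?B"
    then have "(\<theta> - \<psi>) - (\<phi> - \<psi>) \<in> ?B"
      using diff by (rule hom_coboundaries_diff)
    then show "\<theta> - \<phi> \<in> ?B" by simp
  qed
  then show ?thesis
    unfolding coh_class_def by blast
qed

lemma HH_class_self:
  assumes "\<phi> \<in> hom_cocycles A P Q k"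
  shows "\<phi> \<in> HH_class A P Q k \<phi>"
proof -
  have lin: "linear_on_total Q Q (dif Q)"
    using bimodule_dg_space [OF Q] unfolding dg_space_def graded_linear_def by blast
  note DQ = bimodule_dg_space [OF Q]
  have "(\<lambda>_. 0) \<in> hom_cochains A P Q (k - 1)"
    using linear_on_total_0 [OF DQ DQ bimodule_linear(1) [OF Q]]
      linear_on_total_0 [OF DQ DQ bimodule_linear(2) [OF Q]] gr_total [OF A]
    by (intro hom_cochainsI) (simp_all add: total_0 [OF DQ] gr_0 [OF DQ] scl_rules [OF DQ])
  moreover have "hom_diff P Q (k - 1) (\<lambda>_. 0) = 0"
    using linear_on_total_0 [OF DQ DQ lin] by (auto simp: hom_diff_def scl_rules [OF DQ])
  ultimately have "0 \<in> hom_coboundaries A P Q k"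
    unfolding hom_coboundaries_def by (metis image_eqI)
  then show ?thesis
    using assms by (simp add: coh_class_def)
qed

end

text \<open>
  Homogeneous morphisms of bimodules, with the signs that make a morphism of degree \<open>d\<close> send a
  cochain of degree \<open>k\<close> to a cochain of degree \<open>k + d\<close>.
\<close>

definition bimodule_map ::
  "'a::ab_group_add dgalgebra \<Rightarrow> ('a, 'q::ab_group_add) dgbimodule \<Rightarrow> ('a, 'r::ab_group_add) dgbimodule \<Rightarrow>
   int \<Rightarrow> ('q \<Rightarrow> 'r) \<Rightarrow> bool"
where
  "bimodule_map A Q R d g \<longleftrightarrow>
     graded_linear Q R d g \<and>
     (\<forall>p. \<forall>a \<in> gr A p. \<forall>x \<in> total Q. g (lact Q a x) = scl R (koszul (d * p)) (lact R a (g x))) \<and>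
     (\<forall>a \<in> total A. \<forall>x \<in> total Q. g (ract Q x a) = ract R (g x) a)"

definition dg_bimodule_map ::
  "'a::ab_group_add dgalgebra \<Rightarrow> ('a, 'q::ab_group_add) dgbimodule \<Rightarrow> ('a, 'r::ab_group_add) dgbimodule \<Rightarrow>
   int \<Rightarrow> ('q \<Rightarrow> 'r) \<Rightarrow> bool"
where
  "dg_bimodule_map A Q R d g \<longleftrightarrow>
     bimodule_map A Q R d g \<and> (\<forall>x \<in> total Q. dif R (g x) = scl R (koszul d) (g (dif Q x)))"

lemma bimodule_mapD:
  assumes "bimodule_map A Q R d g"
  shows "linear_on_total Q R g"
    and "x \<in> total Q \<Longrightarrow> g x \<in> total R"
    and "x \<in> gr Q p \<Longrightarrow> g x \<in> gr R (p + d)"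
    and "x \<in> total Q \<Longrightarrow> y \<in> total Q \<Longrightarrow> g (x + y) = g x + g y"
    and "x \<in> total Q \<Longrightarrow> g (scl Q c x) = scl R c (g x)"
    and "a \<in> gr A p \<Longrightarrow> x \<in> total Q \<Longrightarrow> g (lact Q a x) = scl R (koszul (d * p)) (lact R a (g x))"
    and "a \<in> total A \<Longrightarrow> x \<in> total Q \<Longrightarrow> g (ract Q x a) = ract R (g x) a"
  using assms unfolding bimodule_map_def graded_linear_def linear_on_total_def by blast+

lemma dg_bimodule_mapD:
  assumes "dg_bimodule_map A Q R d g"
  shows "bimodule_map A Q R d g"
    and "x \<in> total Q \<Longrightarrow> dif R (g x) = scl R (koszul d) (g (dif Q x))"
  using assms unfolding dg_bimodule_map_def by blast+

lemma bimodule_map_comp_cochain: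
  assumes A: "dg_space A" and Q: "dg_bimodule A Q" and R: "dg_bimodule A R"
    and g: "bimodule_map A Q R d g" and \<phi>: "\<phi> \<in> hom_cochains A P Q k"
  shows "g \<circ> \<phi> \<in> hom_cochains A P R (k + d)"
proof -
  note DQ = bimodule_dg_space [OF Q] and DR = bimodule_dg_space [OF R]
  note G = bimodule_mapD [OF g] and F = hom_cochainsD [OF \<phi>]
  have "g 0 = 0"
    using linear_on_total_0 [OF DQ DR G(1)] .
  moreover have "g (\<phi> (lact P a x)) = scl R (koszul ((k + d) * p)) (lact R a (g (\<phi> x)))"
    if "a \<in> gr A p" "x \<in> total P" for a p x
  proof -
    have "g (\<phi> (lact P a x)) = scl R (koszul (k * p)) (g (lact Q a (\<phi> x)))"
      using F(2,7) G(5) that bimodule_total(1) [OF Q] gr_total [OF A] by simp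
    also have "\<dots> = scl R (koszul (k * p) * koszul (d * p)) (lact R a (g (\<phi> x)))"
      using G(6) F(2) that scl_rules(4) [OF DR] by simp
    finally show ?thesis
      by (simp add: koszul_add distrib_right)
  qed
  moreover have "g (\<phi> x) \<in> gr R (p + (k + d))" if "x \<in> gr P p" for x p
    using G(3) [OF F(3) [OF that]] by (simp add: add.assoc)
  ultimately show ?thesis
    using F G by (intro hom_cochainsI) simp_all
qed

text \<open>The sign of \<open>D\<close> splits as \<open>(-1)\<^bsup>k+d\<^esup> = (-1)\<^sup>k (-1)\<^sup>d\<close>, and \<open>d g = (-1)\<^sup>d g d\<close> supplies the factor \<open>(-1)\<^sup>d\<close>.\<close>

lemma hom_diff_comp:
  assumes P: "dg_space P" and Q: "dg_bimodule A Q" and R: "dg_bimodule A R"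
    and g: "dg_bimodule_map A Q R d g" and \<phi>: "\<phi> \<in> hom_cochains A P Q k"
  shows "hom_diff P R (k + d) (g \<circ> \<phi>) = (\<lambda>x. scl R (koszul d) (g (hom_diff P Q k \<phi> x)))"
proof
  fix x
  note DQ = bimodule_dg_space [OF Q] and DR = bimodule_dg_space [OF R]
  note G = bimodule_mapD [OF dg_bimodule_mapD(1) [OF g]] and F = hom_cochainsD [OF \<phi>]
  show "hom_diff P R (k + d) (g \<circ> \<phi>) x = scl R (koszul d) (g (hom_diff P Q k \<phi> x))"
  proof (cases "x \<in> total P")
    case True
    then have T: "\<phi> x \<in> total Q" "\<phi> (dif P x) \<in> total Q"
      using F(2) dif_total [OF P] by auto
    then have "g (dif Q (\<phi> x) - scl Q (koszul k) (\<phi> (dif P x)))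
        = g (dif Q (\<phi> x)) - scl R (koszul k) (g (\<phi> (dif P x)))"
      using linear_on_total_diff [OF DQ G(1)] G(5) dif_total [OF DQ] total_scl [OF DQ] by simp
    then show ?thesis
      using True T dg_bimodule_mapD(2) [OF g] scl_rules [OF DR]
      by (simp add: hom_diff_def koszul_add mult.commute)
  next
    case False
    then show ?thesis
      using linear_on_total_0 [OF DQ DR G(1)] scl_rules [OF DR] by (simp add: hom_diff_def)
  qed
qed

lemma dg_bimodule_map_comp_cocycle:
  assumes A: "dg_space A" and P: "dg_bimodule A P" and Q: "dg_bimodule A Q" and R: "dg_bimodule A R"
    and g: "dg_bimodule_map A Q R d g" and \<phi>: "\<phi> \<in> hom_cocycles A P Q k"
  shows "g \<circ> \<phi> \<in> hom_cocycles A P R (k + d)"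
proof -
  have \<phi>': "\<phi> \<in> hom_cochains A P Q k" "hom_diff P Q k \<phi> = (\<lambda>_. 0)"
    using \<phi> by (auto simp: hom_cocycles_def)
  have "g 0 = 0"
    using linear_on_total_0 [OF bimodule_dg_space [OF Q] bimodule_dg_space [OF R]
        bimodule_mapD(1) [OF dg_bimodule_mapD(1) [OF g]]] .
  then show ?thesis
    using bimodule_map_comp_cochain [OF A Q R dg_bimodule_mapD(1) [OF g] \<phi>'(1)]
      hom_diff_comp [OF bimodule_dg_space [OF P] Q R g \<phi>'(1)] \<phi>'(2)
      scl_rules(6) [OF bimodule_dg_space [OF R]]
    by (simp add: hom_cocycles_def)
qed

text \<open>
  If \<open>\<psi>\<close> and \<open>\<phi>\<close> differ by \<open>D\<theta>\<close>, then \<open>g\<psi>\<close> and \<open>g\<phi>\<close> differ by \<open>g (D\<theta>) = (-1)\<^sup>d D (g\<theta>)\<close>; the sign is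
  absorbed into the cochain.
\<close>

lemma dg_bimodule_map_comp_class:
  assumes A: "dg_space A" and P: "dg_bimodule A P" and Q: "dg_bimodule A Q" and R: "dg_bimodule A R"
    and g: "dg_bimodule_map A Q R d g" and \<phi>: "\<phi> \<in> hom_cocycles A P Q k"
    and \<psi>: "\<psi> \<in> HH_class A P Q k \<phi>"
  shows "HH_class A P R (k + d) (g \<circ> \<psi>) = HH_class A P R (k + d) (g \<circ> \<phi>)"
proof (rule HH_class_eqI [OF A P R])
  note DP = bimodule_dg_space [OF P] and DQ = bimodule_dg_space [OF Q] and DR = bimodule_dg_space [OF R]
  note gm = dg_bimodule_mapD(1) [OF g]
  have "\<psi> \<in> hom_cochains A P Q k" "\<phi> \<in> hom_cochains A P Q k" "\<psi> - \<phi> \<in> hom_coboundaries A P Q k"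
    using \<phi> \<psi> by (auto simp: coh_class_def hom_cocycles_def)
  then obtain \<theta> where \<theta>: "\<theta> \<in> hom_cochains A P Q (k - 1)" "\<psi> - \<phi> = hom_diff P Q (k - 1) \<theta>"
    unfolding hom_coboundaries_def by blast
  let ?\<theta> = "\<lambda>x. scl Q (koszul d) (\<theta> x)"
  have \<theta>': "?\<theta> \<in> hom_cochains A P Q (k - 1)"
    using hom_cochains_scl [OF A P Q \<theta>(1)] .
  have in_total: "\<psi> x \<in> total Q" "\<phi> x \<in> total Q" for x
    using \<open>\<psi> \<in> hom_cochains A P Q k\<close> \<open>\<phi> \<in> hom_cochains A P Q k\<close> total_0 [OF DQ]
    by (cases "x \<in> total P"; simp add: hom_cochainsD)+
  have "hom_diff P Q (k - 1) ?\<theta> x = scl Q (koszul d) (hom_diff P Q (k - 1) \<theta> x)" for x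
    using hom_cochainsD(2) [OF \<theta>(1)]
    by (simp add: hom_diff_def dif_scl [OF DQ] scl_rules [OF DQ] mult.commute)
  then have "hom_diff P R (k - 1 + d) (g \<circ> ?\<theta>) = (\<lambda>x. scl R (koszul d) (g (scl Q (koszul d) ((\<psi> - \<phi>) x))))"
    unfolding hom_diff_comp [OF DP Q R g \<theta>'] \<theta>(2) by simp
  also have "\<dots> = (g \<circ> \<psi>) - (g \<circ> \<phi>)"
  proof
    fix x
    have "scl R (koszul d) (g (scl Q (koszul d) (\<psi> x - \<phi> x))) = g (\<psi> x - \<phi> x)"
      using bimodule_mapD(5) [OF gm total_diff [OF DQ in_total]] scl_rules(4,5) [OF DR] by simp
    also have "\<dots> = g (\<psi> x) - g (\<phi> x)"
      using linear_on_total_diff [OF DQ bimodule_mapD(1) [OF gm] in_total] .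
    finally show "scl R (koszul d) (g (scl Q (koszul d) ((\<psi> - \<phi>) x))) = ((g \<circ> \<psi>) - (g \<circ> \<phi>)) x"
      by simp
  qed
  finally have boundary: "hom_diff P R (k - 1 + d) (g \<circ> ?\<theta>) = (g \<circ> \<psi>) - (g \<circ> \<phi>)" .
  have degree: "k - 1 + d = k + d - 1" by simp
  show "(g \<circ> \<psi>) - (g \<circ> \<phi>) \<in> hom_coboundaries A P R (k + d)"
    unfolding hom_coboundaries_def
    using boundary [symmetric] bimodule_map_comp_cochain [OF A Q R gm \<theta>'] unfolding degree
    by (rule image_eqI)
qed

lemma HH_map_class:
  assumes "dg_space A" "dg_bimodule A P" "dg_bimodule A Q" "dg_bimodule A R"
    and "dg_bimodule_map A Q R d g" "\<phi> \<in> hom_cocycles A P Q k"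
  shows "HH_map A P R k d g (HH_class A P Q k \<phi>) = HH_class A P R (k + d) (g \<circ> \<phi>)"
proof -
  have "(\<lambda>\<psi>. HH_class A P R (k + d) (g \<circ> \<psi>)) ` HH_class A P Q k \<phi> = {HH_class A P R (k + d) (g \<circ> \<phi>)}"
    using dg_bimodule_map_comp_class [OF assms] HH_class_self [OF assms(1-3,6)] by blast
  then show ?thesis
    unfolding HH_map_def by simp
qed

text \<open>
  Each identity required of \<open>g\<close> can be checked on preimages under \<open>p\<close>, homogeneous ones where the
  degree matters. For \<open>p = f\<close> and \<open>h\<close> the left multiplication by the dual class, this makes \<open>f\<^sub>!\<close> a
  morphism, so that it acts on Hochschild cohomology.
\<close>

lemma dg_morphism_factor:
  assumes E: "dg_bimodule A E" and Q: "dg_bimodule A Q" and A: "dg_space A"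
    and p: "dg_bimodule_map A E Q 0 p" and onto: "p ` total E = total Q"
    and h: "dg_bimodule_map A E R d h" and factor: "\<And>x. x \<in> total E \<Longrightarrow> g (p x) = h x"
  shows "dg_bimodule_map A Q R d g"
proof -
  note DE = bimodule_dg_space [OF E] and DQ = bimodule_dg_space [OF Q]
  note pm = dg_bimodule_mapD(1) [OF p] and hm = dg_bimodule_mapD(1) [OF h]
  note p' = bimodule_mapD [OF pm] and h' = bimodule_mapD [OF hm]
  have lift: "\<exists>x. x \<in> total E \<and> p x = y" if "y \<in> total Q" for y
    using that onto by (metis imageE)
  have p_lact: "p (lact E a x) = lact Q a (p x)" if "a \<in> gr A q" "x \<in> total E" for a q x
    using p'(6) [OF that] scl_rules(5) [OF DQ] by simp
  have p_dif: "p (dif E x) = dif Q (p x)" if "x \<in> total E" for x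
    using dg_bimodule_mapD(2) [OF p that] scl_rules(5) [OF DQ] by simp
  have "linear_on_total Q R g"
    unfolding linear_on_total_def
  proof (intro conjI ballI allI)
    fix y z c assume "y \<in> total Q" "z \<in> total Q"
    then obtain x w where x: "x \<in> total E" "p x = y" and w: "w \<in> total E" "p w = z"
      using lift by metis
    have gx: "g y = h x" "g z = h w" using factor x w by auto
    show "g (y + z) = g y + g z"
      using factor [OF total_add [OF DE x(1) w(1)]] p'(4) [OF x(1) w(1)] h'(4) [OF x(1) w(1)] x w gx
      by simp
    show "g y \<in> total R"
      using gx h'(2) x by simp
    show "g (scl Q c y) = scl R c (g y)"
      using factor [OF total_scl [OF DE x(1)], of c] p'(5) [OF x(1)] h'(5) [OF x(1)] x gx by simp
  qed
  moreover have "g y \<in> gr R (q + d)" if y: "y \<in> gr Q q" for y q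
  proof -
    have "graded_linear E Q 0 p"
      using pm unfolding bimodule_map_def by blast
    then obtain x where "x \<in> gr E q" "p x = y"
      using homogeneous_preimage [OF DE DQ _ onto y] by blast
    then show ?thesis
      using factor [of x] h'(3) gr_total [OF DE] by simp
  qed
  moreover have "g (lact Q a y) = scl R (koszul (d * q)) (lact R a (g y))"
    if a: "a \<in> gr A q" and y: "y \<in> total Q" for a q y
  proof -
    obtain x where x: "x \<in> total E" "p x = y" using lift [OF y] by blast
    then show ?thesis
      using factor [of x] factor [of "lact E a x"] p_lact [OF a] h'(6) [OF a]
        bimodule_total(1) [OF E] gr_total [OF A a] by simp
  qed
  moreover have "g (ract Q y a) = ract R (g y) a" if a: "a \<in> total A" and y: "y \<in> total Q" for a y
  proof -
    obtain x where x: "x \<in> total E" "p x = y" using lift [OF y] by blast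
    then show ?thesis
      using factor [of x] factor [of "ract E x a"] p'(7) [OF a] h'(7) [OF a]
        bimodule_total(2) [OF E a] by simp
  qed
  moreover have "dif R (g y) = scl R (koszul d) (g (dif Q y))" if y: "y \<in> total Q" for y
  proof -
    obtain x where x: "x \<in> total E" "p x = y" using lift [OF y] by blast
    then show ?thesis
      using factor [of x] factor [of "dif E x"] p_dif dg_bimodule_mapD(2) [OF h] dif_total [OF DE]
      by simp
  qed
  ultimately show ?thesis
    unfolding dg_bimodule_map_def bimodule_map_def graded_linear_def by blast
qed

lemma cdga_morphism_dg_bimodule_map:
  assumes f: "cdga_morphism A B f"
  shows "dg_bimodule_map A (self_bimodule A) (bimodule_along B f) 0 f"
proof -
  have A: "cdga A" and B: "cdga B" and lin: "graded_linear A B 0 f"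
    and mul: "\<forall>a \<in> total A. \<forall>b \<in> total A. f (mul A a b) = mul B (f a) (f b)"
    and dif: "\<forall>a \<in> total A. f (dif A a) = dif B (f a)"
    using f unfolding cdga_morphism_def by blast+
  then show ?thesis
    using gr_total [OF cdga_dg_space [OF A]] scl_rules(5) [OF cdga_dg_space [OF B]]
    by (simp add: dg_bimodule_map_def bimodule_map_def graded_linear_def linear_on_total_def)
qed

section \<open>Multiplication by cohomology classes\<close>

context
  fixes A :: "'a::ab_group_add dgalgebra"
  assumes A: "cdga A"
begin

lemma self_bimodule: "dg_bimodule A (self_bimodule A)"
  using dg_bimodule_along [OF cdga_morphism_id [OF A]] .

text \<open>
  Moving \<open>a\<close> past an element of degree \<open>p\<close> costs the sign \<open>(-1)\<^bsup>dp\<^esup>\<close> of graded commutativity, which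
  is the one in \<open>bimodule_map\<close>. Besides cocycles, the lemma serves for the primitive
  \<open>\<beta>\<close> of a coboundary.
\<close>

lemma left_mul_bimodule_map:
  assumes a: "a \<in> gr A d"
  shows "bimodule_map A (self_bimodule A) (self_bimodule A) d (mul A a)"
proof -
  have aT: "a \<in> total A"
    using gr_total [OF cdga_dg_space [OF A] a] .
  have "linear_on_total A A (mul A a)"
    using mul_linear_right [OF A aT] .
  moreover have "mul A a x \<in> gr A (p + d)" if "x \<in> gr A p" for x p
    using mul_gr [OF A a that] by (simp add: add.commute)
  ultimately show ?thesis
    using mul_graded_commute_total [OF A a] mul_assoc [OF A aT]
    by (simp add: bimodule_map_def graded_linear_def linear_on_total_def)
qed

lemma left_mul_dg_bimodule_map:
  assumes a: "a \<in> cocycles A d"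
  shows "dg_bimodule_map A (self_bimodule A) (self_bimodule A) d (mul A a)"
proof -
  have a': "a \<in> gr A d" "dif A a = 0"
    using a by (auto simp: cocycles_def)
  have "mul A 0 x = 0" if "x \<in> total A" for x
    using linear_on_total_0 [OF cdga_dg_space [OF A] cdga_dg_space [OF A] mul_linear_left [OF A that]] .
  then show ?thesis
    using left_mul_bimodule_map [OF a'(1)] leibniz [OF A a'(1)] a'(2)
    by (simp add: dg_bimodule_map_def)
qed

text \<open>
  For a cocycle \<open>\<phi>\<close> the Leibniz rule gives \<open>(d\<beta>) \<phi> = D (\<beta>\<phi>)\<close>, so the class of the product depends
  only on the class of the coefficient.
\<close>

lemma HH_class_mul_coboundary:
  assumes P: "dg_bimodule A P" and a: "a \<in> cocycles A d" and b: "b \<in> cls A d a"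
    and \<phi>: "\<phi> \<in> hom_cocycles A P (self_bimodule A) k"
  shows "HH_class A P (self_bimodule A) (k + d) (mul A b \<circ> \<phi>)
       = HH_class A P (self_bimodule A) (k + d) (mul A a \<circ> \<phi>)"
proof (rule HH_class_eqI [OF cdga_dg_space [OF A] P self_bimodule])
  note D = cdga_dg_space [OF A] and T = gr_total [OF cdga_dg_space [OF A]]
  obtain \<beta> where \<beta>: "\<beta> \<in> gr A (d - 1)" "b - a = dif A \<beta>" and bT: "b \<in> total A" and aT: "a \<in> total A"
    using a b T by (auto simp: coh_class_def coboundaries_def cocycles_def)
  have \<phi>': "\<phi> \<in> hom_cochains A P (self_bimodule A) k" "\<And>x. hom_diff P (self_bimodule A) k \<phi> x = 0"
    using \<phi> by (auto simp: hom_cocycles_def)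
  have "hom_diff P (self_bimodule A) (k + (d - 1)) (mul A \<beta> \<circ> \<phi>) x = ((mul A b \<circ> \<phi>) - (mul A a \<circ> \<phi>)) x" for x
  proof (cases "x \<in> total P")
    case True
    then have \<phi>x: "\<phi> x \<in> total A" "\<phi> (dif P x) \<in> total A"
      using hom_cochainsD(2) [OF \<phi>'(1)] dif_total [OF bimodule_dg_space [OF P]] by auto
    have dif_\<phi>: "dif A (\<phi> x) = scl A (koszul k) (\<phi> (dif P x))"
      using \<phi>'(2) [of x] True by (simp add: hom_diff_def)
    have "mul A \<beta> (dif A (\<phi> x)) = scl A (koszul k) (mul A \<beta> (\<phi> (dif P x)))"
      unfolding dif_\<phi> using mul_linear_right [OF A T [OF \<beta>(1)]] \<phi>x
      unfolding linear_on_total_def by blast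
    then have "dif A (mul A \<beta> (\<phi> x))
        = mul A (b - a) (\<phi> x) + scl A (koszul (k + (d - 1))) (mul A \<beta> (\<phi> (dif P x)))"
      using leibniz [OF A \<beta>(1) \<phi>x(1)] \<beta>(2) scl_rules(4) [OF D] by (simp add: koszul_add mult.commute)
    moreover have "mul A (b - a) (\<phi> x) = mul A b (\<phi> x) - mul A a (\<phi> x)"
      using linear_on_total_diff [OF D mul_linear_left [OF A \<phi>x(1)] bT aT] .
    ultimately show ?thesis
      using True by (simp add: hom_diff_def)
  next
    case False
    then show ?thesis
      using hom_cochainsD(6) [OF \<phi>'(1)] linear_on_total_0 [OF D D mul_linear_right [OF A aT]]
        linear_on_total_0 [OF D D mul_linear_right [OF A bT]]
      by (simp add: hom_diff_def)
  qed
  then have boundary: "hom_diff P (self_bimodule A) (k + (d - 1)) (mul A \<beta> \<circ> \<phi>) =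
      (mul A b \<circ> \<phi>) - (mul A a \<circ> \<phi>)"
    by blast
  have degree: "k + (d - 1) = k + d - 1" by simp
  show "(mul A b \<circ> \<phi>) - (mul A a \<circ> \<phi>) \<in> hom_coboundaries A P (self_bimodule A) (k + d)"
    unfolding hom_coboundaries_def
    using boundary [symmetric] bimodule_map_comp_cochain [OF D self_bimodule self_bimodule
        left_mul_bimodule_map [OF \<beta>(1)] \<phi>'(1)] unfolding degree
    by (rule image_eqI)
qed

lemma HH_mult_class:
  assumes P: "dg_bimodule A P" and a: "a \<in> cocycles A d"
    and \<phi>: "\<phi> \<in> hom_cocycles A P (self_bimodule A) k"
  shows "HH_mult A P (self_bimodule A) k d (cls A d a) (HH_class A P (self_bimodule A) k \<phi>)
       = HH_class A P (self_bimodule A) (k + d) (mul A a \<circ> \<phi>)"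
proof -
  note D = cdga_dg_space [OF A]
  let ?F = "\<lambda>(b, \<psi>). HH_class A P (self_bimodule A) (k + d) (\<lambda>x. lact (self_bimodule A) b (\<psi> x))"
  let ?c = "HH_class A P (self_bimodule A) (k + d) (mul A a \<circ> \<phi>)"
  have F: "?F (b, \<psi>) = HH_class A P (self_bimodule A) (k + d) (mul A b \<circ> \<psi>)" for b \<psi>
    by (simp add: comp_def)
  have "?F (b, \<psi>) = ?c" if b: "b \<in> cls A d a" and \<psi>: "\<psi> \<in> HH_class A P (self_bimodule A) k \<phi>" for b \<psi>
  proof -
    have "b \<in> cocycles A d"
      using b by (simp add: coh_class_def)
    then show ?thesis
      unfolding F
      using dg_bimodule_map_comp_class [OF D P self_bimodule self_bimodule left_mul_dg_bimodule_map \<phi> \<psi>]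
        HH_class_mul_coboundary [OF P a b \<phi>] by simp
  qed
  moreover have "a \<in> cls A d a"
  proof -
    have "dif A 0 = 0"
      using dif_add [OF D, of 0 0] total_0 [OF D] by simp
    then have "0 \<in> coboundaries A d"
      unfolding coboundaries_def using gr_0 [OF D] by (metis image_eqI)
    then show ?thesis
      using a by (simp add: coh_class_def)
  qed
  moreover have "\<phi> \<in> HH_class A P (self_bimodule A) k \<phi>"
    using HH_class_self [OF D P self_bimodule \<phi>] .
  ultimately have "?F ` (cls A d a \<times> HH_class A P (self_bimodule A) k \<phi>) = {?c}"
    by (intro equalityI subsetI) (fastforce, force)
  then show ?thesis
    unfolding HH_mult_def by (simp only: the_elem_eq)
qed

end

section \<open>The shriek map\<close>

text \<open>
  The functional \<open>\<epsilon>\<^sub>B \<circ> f\<close> lives in degree \<open>n\<close>, so its representative \<open>\<alpha>\<close> has degree \<open>m - n\<close>; as it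
  vanishes on coboundaries \<open>d z\<close>, where it is \<open>\<epsilon>\<^sub>B (d (f z))\<close>, \<open>\<alpha>\<close> is a cocycle.
\<close>

lemma poincare_dual_of_morphism:
  assumes A: "poincare_duality_algebra A m \<epsilon>A" and B: "poincare_duality_algebra B n \<epsilon>B"
    and f: "cdga_morphism A B f"
  obtains \<alpha> where "\<alpha> \<in> cocycles A (int m - int n)" "\<And>z. z \<in> total A \<Longrightarrow> \<epsilon>A (mul A \<alpha> z) = \<epsilon>B (f z)"
proof -
  have lin: "linear_on_total A B f" and deg: "\<And>p a. a \<in> gr A p \<Longrightarrow> f a \<in> gr B p"
    and dif: "\<And>a. a \<in> total A \<Longrightarrow> f (dif A a) = dif B (f a)"
    using f unfolding cdga_morphism_def graded_linear_def by simp_all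
  have f_lin: "f z \<in> total B" "f (scl A c z) = scl B c (f z)" if "z \<in> total A" for c z
    using lin that unfolding linear_on_total_def by blast+
  have f_add: "f (y + z) = f y + f z" if "y \<in> total A" "z \<in> total A" for y z
    using lin that unfolding linear_on_total_def by blast
  obtain \<alpha> where \<alpha>: "\<alpha> \<in> gr A (int m - int n)" "\<And>z. z \<in> total A \<Longrightarrow> \<epsilon>A (mul A \<alpha> z) = \<epsilon>B (f z)"
  proof (rule duality_representation [OF A, of "\<lambda>z. \<epsilon>B (f z)" "int n"])
    show "\<epsilon>B (f (y + z)) = \<epsilon>B (f y) + \<epsilon>B (f z)" if "y \<in> total A" "z \<in> total A" for y z
      using that by (simp add: f_add f_lin orientation_add [OF B])
    show "\<epsilon>B (f (scl A c z)) = c * \<epsilon>B (f z)" if "z \<in> total A" for c z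
      using that by (simp add: f_lin orientation_scl [OF B])
    show "\<epsilon>B (f z) = 0" if "q \<noteq> int n" "z \<in> gr A q" for q z
      using that orientation_degree [OF B deg] by blast
  qed blast
  have "dif A \<alpha> = 0"
  proof (rule dif_eq_0_if_orthogonal [OF A \<alpha>(1)])
    fix z assume "z \<in> total A"
    then show "\<epsilon>A (mul A \<alpha> (dif A z)) = 0"
      using \<alpha>(2) dif f_lin(1) orientation_dif [OF B] dif_total [OF PD_dg_space [OF A]] by simp
  qed
  then show thesis
    using that \<alpha> by (simp add: cocycles_def)
qed

text \<open>As \<open>f\<close> is multiplicative, both sides represent the functional \<open>z \<mapsto> \<epsilon>\<^sub>B (f (a z))\<close>.\<close>

lemma shriek_of_image:
  assumes A: "poincare_duality_algebra A m \<epsilon>A" and f: "cdga_morphism A B f"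
    and \<alpha>: "\<alpha> \<in> total A" "\<And>z. z \<in> total A \<Longrightarrow> \<epsilon>A (mul A \<alpha> z) = \<epsilon>B (f z)"
    and a: "a \<in> total A"
  shows "shriek A \<epsilon>A B \<epsilon>B f (f a) = mul A \<alpha> a"
  unfolding shriek_def
proof (rule duality_inv_eqI [OF A])
  note M = mul_total [OF PD_cdga [OF A]]
  show "mul A \<alpha> a \<in> total A"
    using M \<alpha>(1) a by blast
  fix z assume z: "z \<in> total A"
  have "f (mul A a z) = mul B (f a) (f z)"
    using f a z unfolding cdga_morphism_def by blast
  then show "\<epsilon>A (mul A (mul A \<alpha> a) z) = \<epsilon>B (mul B (f a) (f z))"
    using mul_assoc [OF PD_cdga [OF A] \<alpha>(1) a z] \<alpha>(2) [OF M [OF a z]] by simp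
qed

theorem theorem1:
  fixes M :: "'s topology" and atlasM :: "'s chart set" and m :: nat
    and N :: "'t topology" and atlasN :: "'t chart set" and n :: nat
    and e :: "'t \<Rightarrow> 's"
    and A :: "'a::ab_group_add dgalgebra" and \<epsilon>A :: "'a \<Rightarrow> rat"
    and B :: "'b::ab_group_add dgalgebra" and \<epsilon>B :: "'b \<Rightarrow> rat"
    and f :: "'a \<Rightarrow> 'b"
    and Z :: "('u::ab_group_add, 'v::ab_group_add) cdga_arrow list"
    and x xstar :: 'a and y :: 'b and S :: "'a set"
    and P :: "('a, 'p::ab_group_add) dgbimodule" and \<rho> :: "'p \<Rightarrow> 'a"
  assumes "oriented_smooth_manifold m M atlasM" "compact_space M" "simply_connected_space M"
    and "oriented_smooth_manifold n N atlasN" "compact_space N" "simply_connected_space N"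
    and "smooth_embedding n N atlasN m M atlasM e"
    and "cdga_model Z A B f N M e"
    and "poincare_duality_algebra A m \<epsilon>A"
    and "poincare_duality_algebra B n \<epsilon>B"
    and "f ` total A = total B"
    and "y \<in> cocycles B (int n)" "\<epsilon>B y = 1"
    and "x \<in> cocycles A (int n)" "f x = y"
    and "homogeneous_basis A S" "x \<in> S" "\<forall>a \<in> total A. dual_functional A S x a = \<epsilon>B (f a)"
    and "xstar = duality_inv A \<epsilon>A (dual_functional A S x)"
    and "semifree_resolution A P \<rho>"
  shows "\<forall>k. \<forall>c \<in> HH A P (self_bimodule A) k.
           HH_map A P (self_bimodule A) k (int m - int n) (shriek A \<epsilon>A B \<epsilon>B f)
             (HH_map A P (bimodule_along B f) k 0 f c)
         = HH_mult A P (self_bimodule A) k (int m - int n) (cls A (int m - int n) xstar) c"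
proof (intro allI ballI)
  fix k c assume "c \<in> HH A P (self_bimodule A) k"
  then obtain \<phi> where \<phi>: "\<phi> \<in> hom_cocycles A P (self_bimodule A) k"
    and c: "c = HH_class A P (self_bimodule A) k \<phi>"
    unfolding HH_def coh_space_def by blast
  let ?d = "int m - int n" and ?sh = "shriek A \<epsilon>A B \<epsilon>B f"
  note PDA = \<open>poincare_duality_algebra A m \<epsilon>A\<close> and PDB = \<open>poincare_duality_algebra B n \<epsilon>B\<close>
  have f: "cdga_morphism A B f"
    using \<open>cdga_model Z A B f N M e\<close> by (simp add: cdga_model_def)
  note CA = PD_cdga [OF PDA] and DA = PD_dg_space [OF PDA]
  have P: "dg_bimodule A P"
    using \<open>semifree_resolution A P \<rho>\<close> by (simp add: semifree_resolution_def semifree_bimodule_def)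
  note SA = self_bimodule [OF CA] and SB = dg_bimodule_along [OF f]
  obtain \<alpha> where \<alpha>: "\<alpha> \<in> cocycles A ?d" "\<And>z. z \<in> total A \<Longrightarrow> \<epsilon>A (mul A \<alpha> z) = \<epsilon>B (f z)"
    using poincare_dual_of_morphism [OF PDA PDB f] by blast
  have \<alpha>T: "\<alpha> \<in> total A"
    using \<alpha>(1) gr_total [OF DA] by (auto simp: cocycles_def)
  have "xstar = \<alpha>"
    unfolding \<open>xstar = duality_inv A \<epsilon>A (dual_functional A S x)\<close>
    using \<alpha>(2) \<open>\<forall>a \<in> total A. dual_functional A S x a = \<epsilon>B (f a)\<close>
    by (intro duality_inv_eqI [OF PDA \<alpha>T]) simp
  have sh_f: "?sh (f a) = mul A \<alpha> a" if "a \<in> total A" for a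
    using shriek_of_image [OF PDA f \<alpha>T \<alpha>(2) that] .
  note f_map = cdga_morphism_dg_bimodule_map [OF f]
  have sh_map: "dg_bimodule_map A (bimodule_along B f) (self_bimodule A) ?d ?sh"
    using \<open>f ` total A = total B\<close> sh_f
    by (intro dg_morphism_factor [OF SA SB DA f_map _ left_mul_dg_bimodule_map [OF CA \<alpha>(1)]]) auto
  \<comment> \<open>Cochains vanish outside of the carrier of \<open>P\<close>, so this holds for all \<open>x\<close> and the two cochains
    below are equal as functions.\<close>
  have "\<phi> x \<in> total A" for x
    using \<phi> hom_cochainsD(2,6) [of \<phi> A P "self_bimodule A" k x] total_0 [OF DA]
    by (cases "x \<in> total P") (auto simp: hom_cocycles_def)
  then have same_cochain: "?sh \<circ> (f \<circ> \<phi>) = mul A \<alpha> \<circ> \<phi>"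
    using sh_f by (simp add: fun_eq_iff)
  have f\<phi>: "f \<circ> \<phi> \<in> hom_cocycles A P (bimodule_along B f) k"
    using dg_bimodule_map_comp_cocycle [OF DA P SA SB f_map \<phi>] by simp
  have "HH_map A P (bimodule_along B f) k 0 f c = HH_class A P (bimodule_along B f) k (f \<circ> \<phi>)"
    using HH_map_class [OF DA P SA SB f_map \<phi>] c by simp
  then have "HH_map A P (self_bimodule A) k ?d ?sh (HH_map A P (bimodule_along B f) k 0 f c)
      = HH_class A P (self_bimodule A) (k + ?d) (mul A \<alpha> \<circ> \<phi>)"
    using HH_map_class [OF DA P SB SA sh_map f\<phi>] same_cochain by simp
  also have "\<dots> = HH_mult A P (self_bimodule A) k ?d (cls A ?d xstar) c"
    using HH_mult_class [OF CA P \<alpha>(1) \<phi>] c \<open>xstar = \<alpha>\<close> by simp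
  finally show "HH_map A P (self_bimodule A) k ?d ?sh (HH_map A P (bimodule_along B f) k 0 f c)
      = HH_mult A P (self_bimodule A) k ?d (cls A ?d xstar) c" .
qed

end
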